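(* Let $\Sigma$ be a many-sorted signature split by $\Lambda$ into $\{\Sigma_\lambda:\lambda\in\Lambda\}$, and let $\mathbb{A}$ be a $\Sigma$-structure. For each $\lambda\in\Lambda$ let $\kappa_\lambda\ge\max\{|\Sigma_\lambda|,\aleph_0,\sup\{|\sigma^{\mathbb{A}}|:\sigma\in\mathcal{S}^{\ge}_{\mathbb{A}}(\lambda)\}\}$ be a cardinal. Then there is a $\Sigma$-structure $\mathbb{B}$ containing $\mathbb{A}$ as an elementary substructure with $|\sigma^{\mathbb{B}}|=\kappa_\lambda$ for every $\lambda\in\Lambda$ and $\sigma\in\mathcal{S}^{\ge}_{\mathbb{A}}(\lambda)$, and $\sigma^{\mathbb{B}}=\sigma^{\mathbb{A}}$ for every $\sigma\in\mathcal{S}^{<}_{\mathbb{A}}$.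
   Context: Many-sorted first-order logic: a signature $\Sigma$ has a nonempty set $\mathcal{S}_\Sigma$ of sorts, a set $\mathcal{F}_\Sigma$ of function symbols and a set $\mathcal{P}_\Sigma$ of predicate symbols (including an equality symbol for each sort), with sorted arities; $|\Sigma|=|\mathcal{S}_\Sigma|+|\mathcal{F}_\Sigma|+|\mathcal{P}_\Sigma|$. A $\Sigma$-structure interprets each sort $\sigma$ as a nonempty set $\sigma^{\mathbb{A}}$. $\mathbb{A}$ is an elementary substructure of $\mathbb{B}$ if it is a substructure and for all formulas $\varphi$ and assignments $\nu$ into $\mathbb{A}$, $(\mathbb{A},\nu)\models\varphi$ iff $(\mathbb{B},\nu)\models\varphi$. $\Sigma$ is split by $\Lambda$ into signatures $\{\Sigma_\lambda:\lambda\in\Lambda\}$ if $\Lambda$ is a partition of $\mathcal{S}_\Sigma$, each $\Sigma_\lambda$ is a signature with sort set $\lambda$, $\mathcal{F}_\Sigma=\bigcup_\lambda\mathcal{F}_{\Sigma_\lambda}$ and $\mathcal{P}_\Sigma=\bigcup_\lambda\mathcal{P}_{\Sigma_\lambda}$. For a structure $\mathbb{A}$, $\mathcal{S}^{\ge}_{\mathbb{A}}=\{\sigma:|\sigma^{\mathbb{A}}|\ge\aleph_0\}$, $\mathcal{S}^{<}_{\mathbb{A}}=\mathcal{S}_\Sigma\setminus\mathcal{S}^{\ge}_{\mathbb{A}}$, and $\mathcal{S}^{\ge}_{\mathbb{A}}(\lambda)=\mathcal{S}^{\ge}_{\mathbb{A}}\cap\lambda$. *)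

theory Defs
  imports Main "HOL-Library.Disjoint_Sets"
begin

unbundle cardinal_syntax

section \<open>Signatures\<close>

text \<open>Equality is a genuine family of predicate symbols, one for each sort; hence it counts
  towards the cardinality of the signature.  Arities of length 0 are allowed.\<close>

record ('s, 'f, 'p) signature =
  sorts :: "'s set"
  funs :: "'f set"
  preds :: "'p set"
  fun_arity :: "'f \<Rightarrow> 's list \<times> 's"
  pred_arity :: "'p \<Rightarrow> 's list"
  eq_sym :: "'s \<Rightarrow> 'p"

definition is_signature :: "('s, 'f, 'p) signature \<Rightarrow> bool" where
  "is_signature \<Sigma> \<longleftrightarrow>
     sorts \<Sigma> \<noteq> {} \<and>
     (\<forall>f\<in>funs \<Sigma>. set (fst (fun_arity \<Sigma> f)) \<subseteq> sorts \<Sigma> \<and> snd (fun_arity \<Sigma> f) \<in> sorts \<Sigma>) \<and>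
     (\<forall>p\<in>preds \<Sigma>. set (pred_arity \<Sigma> p) \<subseteq> sorts \<Sigma>) \<and>
     (\<forall>\<sigma>\<in>sorts \<Sigma>. eq_sym \<Sigma> \<sigma> \<in> preds \<Sigma> \<and> pred_arity \<Sigma> (eq_sym \<Sigma> \<sigma>) = [\<sigma>, \<sigma>])"

definition sig_card :: "('s, 'f, 'p) signature \<Rightarrow> (('s + 'f) + 'p) rel" where
  "sig_card \<Sigma> = ( |sorts \<Sigma>| +c |funs \<Sigma>| ) +c |preds \<Sigma>|"

text \<open>The set \<open>\<Lambda>\<close> consists of sets of sorts, and the signature belonging to
  \<open>l \<in> \<Lambda>\<close> is \<open>\<Sigma>s l\<close>.  Symbols keep their arities.\<close>

definition split_by ::
  "('s, 'f, 'p) signature \<Rightarrow> 's set set \<Rightarrow> ('s set \<Rightarrow> ('s, 'f, 'p) signature) \<Rightarrow> bool" where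
  "split_by \<Sigma> \<Lambda> \<Sigma>s \<longleftrightarrow>
     partition_on (sorts \<Sigma>) \<Lambda> \<and>
     (\<forall>l\<in>\<Lambda>. is_signature (\<Sigma>s l) \<and> sorts (\<Sigma>s l) = l \<and>
        (\<forall>f\<in>funs (\<Sigma>s l). fun_arity (\<Sigma>s l) f = fun_arity \<Sigma> f) \<and>
        (\<forall>p\<in>preds (\<Sigma>s l). pred_arity (\<Sigma>s l) p = pred_arity \<Sigma> p) \<and>
        (\<forall>\<sigma>\<in>l. eq_sym (\<Sigma>s l) \<sigma> = eq_sym \<Sigma> \<sigma>)) \<and>
     funs \<Sigma> = (\<Union>l\<in>\<Lambda>. funs (\<Sigma>s l)) \<and>
     preds \<Sigma> = (\<Union>l\<in>\<Lambda>. preds (\<Sigma>s l))"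

section \<open>Structures\<close>

text \<open>Values of \<open>fun_interp\<close> and \<open>pred_interp\<close> on argument lists that do not match
  the arity, or for symbols outside the signature, are irrelevant.  The domains of distinct sorts
  are not required to be disjoint.\<close>

record ('s, 'f, 'p, 'a) sorted_struct =
  carrier :: "'s \<Rightarrow> 'a set"
  fun_interp :: "'f \<Rightarrow> 'a list \<Rightarrow> 'a"
  pred_interp :: "'p \<Rightarrow> 'a list \<Rightarrow> bool"

definition tuples :: "('s, 'f, 'p, 'a) sorted_struct \<Rightarrow> 's list \<Rightarrow> 'a list set" where
  "tuples A \<sigma>s = listset (map (carrier A) \<sigma>s)"

definition is_structure :: "('s, 'f, 'p) signature \<Rightarrow> ('s, 'f, 'p, 'a) sorted_struct \<Rightarrow> bool" where
  "is_structure \<Sigma> A \<longleftrightarrow>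
     (\<forall>\<sigma>\<in>sorts \<Sigma>. carrier A \<sigma> \<noteq> {}) \<and>
     (\<forall>f\<in>funs \<Sigma>. \<forall>as\<in>tuples A (fst (fun_arity \<Sigma> f)).
        fun_interp A f as \<in> carrier A (snd (fun_arity \<Sigma> f))) \<and>
     (\<forall>\<sigma>\<in>sorts \<Sigma>. \<forall>a\<in>carrier A \<sigma>. \<forall>b\<in>carrier A \<sigma>.
        pred_interp A (eq_sym \<Sigma> \<sigma>) [a, b] \<longleftrightarrow> a = b)"

definition substructure ::
  "('s, 'f, 'p) signature \<Rightarrow> ('s, 'f, 'p, 'a) sorted_struct \<Rightarrow> ('s, 'f, 'p, 'a) sorted_struct \<Rightarrow> bool" where
  "substructure \<Sigma> A B \<longleftrightarrow>
     is_structure \<Sigma> A \<and> is_structure \<Sigma> B \<and>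
     (\<forall>\<sigma>\<in>sorts \<Sigma>. carrier A \<sigma> \<subseteq> carrier B \<sigma>) \<and>
     (\<forall>f\<in>funs \<Sigma>. \<forall>as\<in>tuples A (fst (fun_arity \<Sigma> f)).
        fun_interp A f as = fun_interp B f as) \<and>
     (\<forall>p\<in>preds \<Sigma>. \<forall>as\<in>tuples A (pred_arity \<Sigma> p).
        pred_interp A p as \<longleftrightarrow> pred_interp B p as)"

text \<open>The isomorphic copy of a structure along an injective renaming of its elements.\<close>

definition copy :: "('a \<Rightarrow> 'b) \<Rightarrow> ('s, 'f, 'p, 'a) sorted_struct \<Rightarrow> ('s, 'f, 'p, 'b) sorted_struct" where
  "copy h A =
     \<lparr>carrier = (\<lambda>\<sigma>. h ` carrier A \<sigma>),
      fun_interp = (\<lambda>f as. h (fun_interp A f (map (inv h) as))),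
      pred_interp = (\<lambda>p as. pred_interp A p (map (inv h) as))\<rparr>"

section \<open>Terms, formulas and satisfaction\<close>

text \<open>Every sort has countably many variables, indexed by natural numbers.\<close>

type_synonym 's var = "nat \<times> 's"

datatype ('s, 'f) trm = Var "'s var" | App 'f "('s, 'f) trm list"

text \<open>The remaining connectives and the universal quantifier are definable as usual.
  Equations are atoms whose predicate symbol is an equality symbol.\<close>

datatype ('s, 'f, 'p) form =
    Atom 'p "('s, 'f) trm list"
  | Neg "('s, 'f, 'p) form"
  | Conj "('s, 'f, 'p) form" "('s, 'f, 'p) form"
  | Exists "'s var" "('s, 'f, 'p) form"

primrec sort_of :: "('s, 'f, 'p) signature \<Rightarrow> ('s, 'f) trm \<Rightarrow> 's" where
  "sort_of \<Sigma> (Var x) = snd x"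
| "sort_of \<Sigma> (App f ts) = snd (fun_arity \<Sigma> f)"

primrec is_term :: "('s, 'f, 'p) signature \<Rightarrow> ('s, 'f) trm \<Rightarrow> bool" where
  "is_term \<Sigma> (Var x) \<longleftrightarrow> snd x \<in> sorts \<Sigma>"
| "is_term \<Sigma> (App f ts) \<longleftrightarrow>
     f \<in> funs \<Sigma> \<and> list_all (is_term \<Sigma>) ts \<and> map (sort_of \<Sigma>) ts = fst (fun_arity \<Sigma> f)"

primrec is_formula :: "('s, 'f, 'p) signature \<Rightarrow> ('s, 'f, 'p) form \<Rightarrow> bool" where
  "is_formula \<Sigma> (Atom p ts) \<longleftrightarrow>
     p \<in> preds \<Sigma> \<and> list_all (is_term \<Sigma>) ts \<and> map (sort_of \<Sigma>) ts = pred_arity \<Sigma> p"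
| "is_formula \<Sigma> (Neg \<phi>) \<longleftrightarrow> is_formula \<Sigma> \<phi>"
| "is_formula \<Sigma> (Conj \<phi> \<psi>) \<longleftrightarrow> is_formula \<Sigma> \<phi> \<and> is_formula \<Sigma> \<psi>"
| "is_formula \<Sigma> (Exists x \<phi>) \<longleftrightarrow> snd x \<in> sorts \<Sigma> \<and> is_formula \<Sigma> \<phi>"

definition is_assignment ::
  "('s, 'f, 'p) signature \<Rightarrow> ('s, 'f, 'p, 'a) sorted_struct \<Rightarrow> ('s var \<Rightarrow> 'a) \<Rightarrow> bool" where
  "is_assignment \<Sigma> A \<nu> \<longleftrightarrow> (\<forall>n. \<forall>\<sigma>\<in>sorts \<Sigma>. \<nu> (n, \<sigma>) \<in> carrier A \<sigma>)"

primrec eval :: "('s, 'f, 'p, 'a) sorted_struct \<Rightarrow> ('s var \<Rightarrow> 'a) \<Rightarrow> ('s, 'f) trm \<Rightarrow> 'a" where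
  "eval A \<nu> (Var x) = \<nu> x"
| "eval A \<nu> (App f ts) = fun_interp A f (map (eval A \<nu>) ts)"

primrec sat :: "('s, 'f, 'p, 'a) sorted_struct \<Rightarrow> ('s var \<Rightarrow> 'a) \<Rightarrow> ('s, 'f, 'p) form \<Rightarrow> bool" where
  "sat A \<nu> (Atom p ts) \<longleftrightarrow> pred_interp A p (map (eval A \<nu>) ts)"
| "sat A \<nu> (Neg \<phi>) \<longleftrightarrow> \<not> sat A \<nu> \<phi>"
| "sat A \<nu> (Conj \<phi> \<psi>) \<longleftrightarrow> sat A \<nu> \<phi> \<and> sat A \<nu> \<psi>"
| "sat A \<nu> (Exists x \<phi>) \<longleftrightarrow> (\<exists>a\<in>carrier A (snd x). sat A (\<nu>(x := a)) \<phi>)"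

definition elementary_substructure ::
  "('s, 'f, 'p) signature \<Rightarrow> ('s, 'f, 'p, 'a) sorted_struct \<Rightarrow> ('s, 'f, 'p, 'a) sorted_struct \<Rightarrow> bool" where
  "elementary_substructure \<Sigma> A B \<longleftrightarrow>
     substructure \<Sigma> A B \<and>
     (\<forall>\<phi> \<nu>. is_formula \<Sigma> \<phi> \<longrightarrow> is_assignment \<Sigma> A \<nu> \<longrightarrow> (sat A \<nu> \<phi> \<longleftrightarrow> sat B \<nu> \<phi>))"

section \<open>Infinite and finite sorts\<close>

definition infinite_sorts :: "('s, 'f, 'p) signature \<Rightarrow> ('s, 'f, 'p, 'a) sorted_struct \<Rightarrow> 's set" where
  "infinite_sorts \<Sigma> A = {\<sigma>\<in>sorts \<Sigma>. natLeq \<le>o |carrier A \<sigma>| }"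

definition finite_sorts :: "('s, 'f, 'p) signature \<Rightarrow> ('s, 'f, 'p, 'a) sorted_struct \<Rightarrow> 's set" where
  "finite_sorts \<Sigma> A = sorts \<Sigma> - infinite_sorts \<Sigma> A"

text \<open>Since an extension of \<open>A\<close> may have to be larger than the element type \<open>'a\<close>, and
  since a cardinal \<open>\<kappa>\<close> is a cardinal order on some type \<open>'k\<close>, extensions are sought over
  the type \<open>'a + 'k\<close>, which always has enough room; there \<open>A\<close> is identified with
  \<open>copy Inl A\<close>.  The following facts show that this is harmless.\<close>

lemma tuples_iff: "as \<in> tuples A \<sigma>s \<longleftrightarrow> list_all2 (\<lambda>a \<sigma>. a \<in> carrier A \<sigma>) as \<sigma>s"
  unfolding tuples_def
  by (induction \<sigma>s arbitrary: as) (auto simp: set_Cons_def list_all2_Cons2)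

lemma tuples_copy: "tuples (copy h A) \<sigma>s = map h ` tuples A \<sigma>s"
proof (induction \<sigma>s)
  case (Cons \<sigma> \<sigma>s)
  have *: "tuples C (\<sigma> # \<sigma>s) = (\<lambda>(a, as). a # as) ` (carrier C \<sigma> \<times> tuples C \<sigma>s)"
    for C :: "('s, 'f, 'p, 'x) sorted_struct" and \<sigma> \<sigma>s
    by (auto simp: tuples_def set_Cons_def)
  show ?case
    unfolding * Cons by (auto simp: copy_def image_iff)
qed (simp add: tuples_def)

lemma is_structure_copy:
  assumes "inj h" "is_structure \<Sigma> A"
  shows "is_structure \<Sigma> (copy h A)"
  using assms unfolding is_structure_def tuples_copy
  by (auto simp: copy_def o_def inj_eq)

lemma eval_copy:
  assumes "inj h"
  shows "eval (copy h A) (h \<circ> \<nu>) t = h (eval A \<nu> t)"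
proof (induction t)
  case (App f ts)
  then have "map (eval (copy h A) (h \<circ> \<nu>)) ts = map h (map (eval A \<nu>) ts)"
    by (simp add: comp_def cong: map_cong)
  then have "eval (copy h A) (h \<circ> \<nu>) (App f ts) =
      fun_interp (copy h A) f (map h (map (eval A \<nu>) ts))"
    by (simp only: eval.simps)
  then show ?case
    using assms by (simp add: copy_def o_def)
qed simp

lemma sat_copy:
  assumes "inj h"
  shows "sat (copy h A) (h \<circ> \<nu>) \<phi> \<longleftrightarrow> sat A \<nu> \<phi>"
proof (induction \<phi> arbitrary: \<nu>)
  case (Atom p ts)
  have "map (eval (copy h A) (h \<circ> \<nu>)) ts = map h (map (eval A \<nu>) ts)"
    by (simp add: eval_copy[OF assms])
  then have "sat (copy h A) (h \<circ> \<nu>) (Atom p ts) \<longleftrightarrow>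
      pred_interp (copy h A) p (map h (map (eval A \<nu>) ts))"
    by (simp only: sat.simps)
  then show ?case
    using assms by (simp add: copy_def o_def)
next
  case (Exists x \<phi>)
  have *: "(h \<circ> \<nu>)(x := h a) = h \<circ> \<nu>(x := a)" for a
    by auto
  have **: "carrier (copy h A) \<sigma> = h ` carrier A \<sigma>" for \<sigma>
    by (simp add: copy_def)
  show ?case
    unfolding sat.simps ** bex_simps * Exists ..
qed simp_all

end

theory Submission
  imports Defs
begin

text \<open>A single ultrapower of \<open>A\<close>, over an ultrafilter on the sets of elements of
  \<open>'k\<close> that contains every cone of finite sets above a given one, leaves the finite
  sorts alone and makes every infinite sort at least as large as \<open>'k\<close>.  It is then cut
  down by a Skolem hull taken in each block \<open>l\<close> separately, using only formulas of
  \<open>\<Sigma>s l\<close>, which keeps the hull of the block below \<open>\<kappa> l\<close>.  The union of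
  these hulls passes the Tarski-Vaught test for all of \<open>\<Sigma>\<close>, because for fixed values of
  the variables outside \<open>l\<close> every \<open>\<Sigma>\<close>-formula is equivalent to a
  \<open>\<Sigma>s l\<close>-formula.\<close>

section \<open>Ultrapowers\<close>

text \<open>The prescribed cardinals vary with the block, while \<open>\<Sigma>\<close> as a whole
  may have more symbols than some \<open>\<kappa> l\<close>. Closing a small block under Skolem
  functions of all \<open>\<Sigma>\<close>-formulas, with parameters from larger blocks, could
  overshoot its bound. What saves the count is that the arity of each symbol lies inside a single
  block: an atom sees one block only, and blocks interact just through connectives and quantifiers.

  The exact sizes come from the seeds of the hulls. Constants together with an injective image of
  \<open>Field (\<kappa> l)\<close> in each infinite sort give the lower bound, the hull gives the
  upper one. The elements are then still functions of type \<open>'k set \<Rightarrow> 'a\<close>.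
  After the cut each single sort fits into \<open>'a + 'k\<close>, old elements on the left and new
  ones injected into \<open>'k\<close>, but nothing bounds the union over all blocks; hence the
  final renaming is chosen sort by sort.\<close>

locale ultrafilter =
  fixes U :: "'i filter"
  assumes neq_bot: "U \<noteq> bot"
    and decides: "eventually P U \<or> eventually (\<lambda>i. \<not> P i) U"
begin

lemma eventually_not_iff: "eventually (\<lambda>i. \<not> P i) U \<longleftrightarrow> \<not> eventually P U"
proof
  assume "eventually (\<lambda>i. \<not> P i) U"
  moreover have False if "eventually P U" "eventually (\<lambda>i. \<not> P i) U"
    using eventually_conj[OF that] neq_bot by (simp add: eventually_False)
  ultimately show "\<not> eventually P U" by blast
qed (use decides in blast)

lemma eventually_const_iff: "eventually (\<lambda>i. P) U \<longleftrightarrow> P"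
  using neq_bot by (simp add: eventually_const)

text \<open>Otherwise \<open>f i\<close> would avoid each of the finitely many values almost
  everywhere, hence all of them at once. This is why finite sorts gain no elements.\<close>

lemma eventually_in_finite:
  assumes "finite S" "\<forall>\<^sub>F i in U. f i \<in> S"
  shows "\<exists>a\<in>S. \<forall>\<^sub>F i in U. f i = a"
proof (rule ccontr)
  assume "\<not> ?thesis"
  then have "\<forall>a\<in>S. \<forall>\<^sub>F i in U. f i \<noteq> a"
    by (simp add: eventually_not_iff)
  then have "\<forall>\<^sub>F i in U. \<forall>a\<in>S. f i \<noteq> a"
    using assms(1) by (simp add: eventually_ball_finite_distrib)
  with assms(2) have "\<forall>\<^sub>F i in U. False"
    by eventually_elim blast
  then show False
    using neq_bot by (simp add: eventually_False)
qed

end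

text \<open>A minimal proper filter below \<open>F\<close> is an ultrafilter. Finer filters are
  smaller, so Zorn's lemma is applied to the reversed order.\<close>

lemma ultrafilter_exists:
  assumes "F \<noteq> bot"
  obtains U where "U \<le> F" "ultrafilter U"
proof -
  let ?A = "{G. G \<le> F \<and> G \<noteq> bot}"
  have "\<exists>m\<in>?A. \<forall>a\<in>?A. a \<le> m \<longrightarrow> a = m"
  proof (rule predicate_Zorn)
    show "partial_order_on ?A (relation_of (\<lambda>a u. u \<le> a) ?A)"
      by (rule partial_order_on_relation_ofI) auto
  next
    fix C assume "C \<in> Chains (relation_of (\<lambda>a u. u \<le> a) ?A)"
    then have C: "C \<subseteq> ?A" "\<And>a b. a \<in> C \<Longrightarrow> b \<in> C \<Longrightarrow> a \<le> b \<or> b \<le> a"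
      by (fastforce simp: Chains_def relation_of_def)+
    show "\<exists>u\<in>?A. \<forall>a\<in>C. u \<le> a"
    proof (cases "C = {}")
      case True
      with assms show ?thesis by auto
    next
      case False
      \<comment> \<open>A chain is directed downwards, so a property eventual for the infimum is
        already eventual for a member; an infimum of proper filters is therefore proper.\<close>
      have "eventually P (Inf C) \<longleftrightarrow> (\<exists>b\<in>C. eventually P b)" for P
        by (rule eventually_Inf_base[OF False]) (metis C(2) inf.absorb1 inf.absorb2 order_refl)
      then have "Inf C \<noteq> bot"
        using C(1) by (auto simp: trivial_limit_def)
      moreover have "Inf C \<le> F"
        using False C(1) by (blast intro: Inf_lower2)
      ultimately show ?thesis
        by (intro bexI[of _ "Inf C"]) (auto intro: Inf_lower)
    qed
  qed
  then obtain U where U: "U \<le> F" "U \<noteq> bot" "\<And>G. G \<le> U \<Longrightarrow> G \<noteq> bot \<Longrightarrow> G = U"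
    by (auto intro: order_trans)
  have "eventually P U \<or> eventually (\<lambda>i. \<not> P i) U" for P
  proof (rule disjCI)
    assume *: "\<not> eventually (\<lambda>i. \<not> P i) U"
    \<comment> \<open>Adjoining \<open>P\<close> keeps the filter proper, because the negation of
      \<open>P\<close> is not eventual; minimality then says that nothing new was adjoined.\<close>
    have "inf U (principal {i. P i}) \<noteq> bot"
      using * by (simp add: trivial_limit_def eventually_inf_principal)
    then have "inf U (principal {i. P i}) = U"
      by (intro U(3)) auto
    moreover have "eventually P (inf U (principal {i. P i}))"
      by (simp add: eventually_inf_principal)
    ultimately show "eventually P U" by simp
  qed
  with U(1,2) that show thesis
    by (auto simp: ultrafilter_def)
qed

text \<open>The elements of the ultrapower are chosen representatives of the classes of functions;
  constant functions represent themselves, so that the diagonal embedding sends \<open>a\<close>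
  to \<open>\<lambda>_. a\<close>.\<close>

context ultrafilter
begin

definition rep :: "('i \<Rightarrow> 'a) \<Rightarrow> 'i \<Rightarrow> 'a" where
  "rep f = (if \<exists>a. \<forall>\<^sub>F i in U. f i = a then \<lambda>_. THE a. \<forall>\<^sub>F i in U. f i = a
            else SOME g. \<forall>\<^sub>F i in U. f i = g i)"

lemma rep_eq_const:
  assumes "\<forall>\<^sub>F i in U. f i = a"
  shows "rep f = (\<lambda>_. a)"
proof -
  have "(THE a. \<forall>\<^sub>F i in U. f i = a) = a"
  proof (rule the_equality)
    show "\<forall>\<^sub>F i in U. f i = a" by (rule assms)
  next
    fix b assume "\<forall>\<^sub>F i in U. f i = b"
    with assms have "\<forall>\<^sub>F i in U. b = a" by eventually_elim simp
    then show "b = a" by (simp add: eventually_const_iff)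
  qed
  with assms show ?thesis by (auto simp: rep_def)
qed

lemma rep_const [simp]: "rep (\<lambda>_. a) = (\<lambda>_. a)"
  by (rule rep_eq_const) simp

lemma eventually_rep: "\<forall>\<^sub>F i in U. rep f i = f i"
proof (cases "\<exists>a. \<forall>\<^sub>F i in U. f i = a")
  case True
  then obtain a where "\<forall>\<^sub>F i in U. f i = a" by blast
  then show ?thesis
    using rep_eq_const[of f a] by (auto elim: eventually_mono)
next
  case False
  have "\<forall>\<^sub>F i in U. f i = (SOME g. \<forall>\<^sub>F i in U. f i = g i) i"
    by (rule someI[of "\<lambda>g. \<forall>\<^sub>F i in U. f i = g i" f]) simp
  with False show ?thesis by (simp add: rep_def eq_commute)
qed

text \<open>\<open>rep\<close> consults \<open>f\<close> only through the functions that agree with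
  it almost everywhere, so equivalent functions get literally the same representative.\<close>

lemma rep_cong:
  assumes "\<forall>\<^sub>F i in U. f i = g i"
  shows "rep f = rep g"
proof -
  have *: "(\<forall>\<^sub>F i in U. f i = h i) \<longleftrightarrow> (\<forall>\<^sub>F i in U. g i = h i)" for h
    by (rule eventually_subst) (use assms in \<open>eventually_elim, simp\<close>)
  show ?thesis
    unfolding rep_def * ..
qed

lemma rep_rep [simp]: "rep (rep f) = rep f"
  by (rule rep_cong) (rule eventually_rep)

text \<open>The quotient is realised as the fixed points of \<open>rep\<close>, so that equality in
  the structure is plain equality, as \<open>is_structure\<close> demands of the equality symbols.
  Membership in a sort is required only almost everywhere, because one representative serves all
  sorts to which its class belongs.\<close>

definition ultrapower :: "('s, 'f, 'p, 'a) sorted_struct \<Rightarrow> ('s, 'f, 'p, 'i \<Rightarrow> 'a) sorted_struct" where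
  "ultrapower A =
     \<lparr>carrier = (\<lambda>\<sigma>. {f. rep f = f \<and> (\<forall>\<^sub>F i in U. f i \<in> carrier A \<sigma>)}),
      fun_interp = (\<lambda>f gs. rep (\<lambda>i. fun_interp A f (map (\<lambda>g. g i) gs))),
      pred_interp = (\<lambda>p gs. \<forall>\<^sub>F i in U. pred_interp A p (map (\<lambda>g. g i) gs))\<rparr>"

lemma carrier_ultrapower:
  "carrier (ultrapower A) \<sigma> = {f. rep f = f \<and> (\<forall>\<^sub>F i in U. f i \<in> carrier A \<sigma>)}"
  by (simp add: ultrapower_def)

lemma const_in_carrier_ultrapower [simp]:
  "(\<lambda>_. a) \<in> carrier (ultrapower A) \<sigma> \<longleftrightarrow> a \<in> carrier A \<sigma>"
  by (simp add: carrier_ultrapower eventually_const_iff)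

lemma carrier_ultrapower_finite:
  assumes "finite (carrier A \<sigma>)"
  shows "carrier (ultrapower A) \<sigma> = (\<lambda>a _. a) ` carrier A \<sigma>"
proof
  show "carrier (ultrapower A) \<sigma> \<subseteq> (\<lambda>a _. a) ` carrier A \<sigma>"
  proof
    fix f assume "f \<in> carrier (ultrapower A) \<sigma>"
    then have f: "rep f = f" "\<forall>\<^sub>F i in U. f i \<in> carrier A \<sigma>"
      by (auto simp: carrier_ultrapower)
    obtain a where "a \<in> carrier A \<sigma>" "\<forall>\<^sub>F i in U. f i = a"
      using eventually_in_finite[OF assms f(2)] by blast
    with rep_eq_const[of f a] f(1) show "f \<in> (\<lambda>a _. a) ` carrier A \<sigma>" by simp
  qed
qed auto

lemma eventually_list_eq:
  assumes "\<And>x. x \<in> set xs \<Longrightarrow> \<forall>\<^sub>F i in U. f i x = g i x"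
  shows "\<forall>\<^sub>F i in U. map (f i) xs = map (g i) xs"
proof -
  have "\<forall>\<^sub>F i in U. \<forall>x\<in>set xs. f i x = g i x"
    using assms by (simp add: eventually_ball_finite_distrib)
  then show ?thesis by eventually_elim simp
qed

lemma eval_ultrapower:
  "\<forall>\<^sub>F i in U. eval (ultrapower A) \<nu> t i = eval A (\<lambda>v. \<nu> v i) t"
proof (induction t)
  case (App f ts)
  have "\<forall>\<^sub>F i in U. map (\<lambda>t. eval (ultrapower A) \<nu> t i) ts = map (eval A (\<lambda>v. \<nu> v i)) ts"
    using App by (rule eventually_list_eq)
  moreover have "\<forall>\<^sub>F i in U. eval (ultrapower A) \<nu> (App f ts) i
      = fun_interp A f (map (\<lambda>t. eval (ultrapower A) \<nu> t i) ts)"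
    using eventually_rep[of "\<lambda>i. fun_interp A f (map (\<lambda>t. eval (ultrapower A) \<nu> t i) ts)"]
    by (simp add: ultrapower_def o_def)
  ultimately show ?case
    by eventually_elim (simp only: eval.simps)
qed simp

text \<open>Los's theorem. Negation is where the ultrafilter property enters; the existential case
  chooses witnesses at each index.\<close>

lemma sat_ultrapower:
  "sat (ultrapower A) \<nu> \<phi> \<longleftrightarrow> (\<forall>\<^sub>F i in U. sat A (\<lambda>v. \<nu> v i) \<phi>)"
proof (induction \<phi> arbitrary: \<nu>)
  case (Atom p ts)
  have "\<forall>\<^sub>F i in U. map (\<lambda>t. eval (ultrapower A) \<nu> t i) ts = map (eval A (\<lambda>v. \<nu> v i)) ts"
    by (intro eventually_list_eq eval_ultrapower)
  then have "\<forall>\<^sub>F i in U. pred_interp A p (map (\<lambda>t. eval (ultrapower A) \<nu> t i) ts) \<longleftrightarrow>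
      pred_interp A p (map (eval A (\<lambda>v. \<nu> v i)) ts)"
    by eventually_elim (simp only:)
  then have "(\<forall>\<^sub>F i in U. pred_interp A p (map (\<lambda>t. eval (ultrapower A) \<nu> t i) ts)) \<longleftrightarrow>
      (\<forall>\<^sub>F i in U. pred_interp A p (map (eval A (\<lambda>v. \<nu> v i)) ts))"
    by (rule eventually_subst)
  then show ?case
    by (simp add: ultrapower_def o_def)
next
  case (Neg \<phi>)
  then show ?case by (simp add: eventually_not_iff)
next
  case (Conj \<phi> \<psi>)
  then show ?case by (simp add: eventually_conj_iff)
next
  case (Exists x \<phi>)
  have upd: "(\<lambda>v. (\<nu>(x := f)) v i) = (\<lambda>v. \<nu> v i)(x := f i)" for f i
    by auto
  have IH: "sat (ultrapower A) (\<nu>(x := f)) \<phi> \<longleftrightarrow> (\<forall>\<^sub>F i in U. sat A ((\<lambda>v. \<nu> v i)(x := f i)) \<phi>)" for f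
    unfolding Exists upd ..
  show ?case
  proof
    assume "sat (ultrapower A) \<nu> (Exists x \<phi>)"
    then obtain f where "f \<in> carrier (ultrapower A) (snd x)" "sat (ultrapower A) (\<nu>(x := f)) \<phi>"
      by auto
    then have "\<forall>\<^sub>F i in U. f i \<in> carrier A (snd x)" "\<forall>\<^sub>F i in U. sat A ((\<lambda>v. \<nu> v i)(x := f i)) \<phi>"
      unfolding IH by (auto simp: carrier_ultrapower)
    then show "\<forall>\<^sub>F i in U. sat A (\<lambda>v. \<nu> v i) (Exists x \<phi>)"
      by eventually_elim auto
  next
    assume *: "\<forall>\<^sub>F i in U. sat A (\<lambda>v. \<nu> v i) (Exists x \<phi>)"
    \<comment> \<open>Where no witness exists the value is arbitrary, which happens only off a set
      of the ultrafilter. The element of the ultrapower is the representative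
      \<open>rep f\<close>.\<close>
    define f where "f i = (SOME a. a \<in> carrier A (snd x) \<and> sat A ((\<lambda>v. \<nu> v i)(x := a)) \<phi>)" for i
    have "f i \<in> carrier A (snd x) \<and> sat A ((\<lambda>v. \<nu> v i)(x := f i)) \<phi>"
      if "sat A (\<lambda>v. \<nu> v i) (Exists x \<phi>)" for i
      unfolding f_def by (rule someI_ex) (use that in \<open>simp only: sat.simps, blast\<close>)
    with * have "\<forall>\<^sub>F i in U. f i \<in> carrier A (snd x) \<and> sat A ((\<lambda>v. \<nu> v i)(x := f i)) \<phi>"
      by (rule eventually_mono)
    with eventually_rep[of f]
    have "\<forall>\<^sub>F i in U. rep f i \<in> carrier A (snd x) \<and> sat A ((\<lambda>v. \<nu> v i)(x := rep f i)) \<phi>"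
      by eventually_elim (simp only: simp_thms)
    then have "rep f \<in> carrier (ultrapower A) (snd x)" "sat (ultrapower A) (\<nu>(x := rep f)) \<phi>"
      unfolding IH by (auto simp: carrier_ultrapower eventually_conj_iff)
    then show "sat (ultrapower A) \<nu> (Exists x \<phi>)"
      unfolding sat.simps by blast
  qed
qed

lemma sat_ultrapower_const:
  "sat (ultrapower A) (\<lambda>v _. \<nu> v) \<phi> \<longleftrightarrow> sat A \<nu> \<phi>"
  by (simp add: sat_ultrapower eventually_const_iff)

lemma fun_interp_ultrapower_const:
  "fun_interp (ultrapower A) f (map (\<lambda>a _. a) as) = (\<lambda>_. fun_interp A f as)"
  by (simp add: ultrapower_def o_def)

lemma pred_interp_ultrapower_const:
  "pred_interp (ultrapower A) p (map (\<lambda>a _. a) as) \<longleftrightarrow> pred_interp A p as"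
  by (simp add: ultrapower_def o_def eventually_const_iff)

lemma tuples_ultrapower:
  assumes "gs \<in> tuples (ultrapower A) \<sigma>s"
  shows "\<forall>\<^sub>F i in U. map (\<lambda>g. g i) gs \<in> tuples A \<sigma>s"
  using assms unfolding tuples_iff
proof (induction rule: list_all2_induct)
  case (Cons g gs \<sigma> \<sigma>s)
  then have "\<forall>\<^sub>F i in U. g i \<in> carrier A \<sigma>"
    by (simp add: carrier_ultrapower)
  with Cons.IH show ?case
    by eventually_elim simp
qed simp

lemma is_structure_ultrapower:
  assumes "is_structure \<Sigma> A"
  shows "is_structure \<Sigma> (ultrapower A)"
  unfolding is_structure_def
proof (intro conjI ballI)
  fix \<sigma> assume "\<sigma> \<in> sorts \<Sigma>"
  then obtain a where "a \<in> carrier A \<sigma>"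
    using assms by (fastforce simp: is_structure_def)
  then have "(\<lambda>_. a) \<in> carrier (ultrapower A) \<sigma>" by simp
  then show "carrier (ultrapower A) \<sigma> \<noteq> {}" by blast
next
  fix f gs assume *: "f \<in> funs \<Sigma>" "gs \<in> tuples (ultrapower A) (fst (fun_arity \<Sigma> f))"
  let ?h = "\<lambda>i. fun_interp A f (map (\<lambda>g. g i) gs)"
  from tuples_ultrapower[OF *(2)]
  have "\<forall>\<^sub>F i in U. ?h i \<in> carrier A (snd (fun_arity \<Sigma> f))"
    by eventually_elim (use assms *(1) in \<open>auto simp: is_structure_def\<close>)
  with eventually_rep[of ?h]
  have "\<forall>\<^sub>F i in U. rep ?h i \<in> carrier A (snd (fun_arity \<Sigma> f))"
    by eventually_elim simp
  then have "rep ?h \<in> carrier (ultrapower A) (snd (fun_arity \<Sigma> f))"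
    by (simp add: carrier_ultrapower)
  then show "fun_interp (ultrapower A) f gs \<in> carrier (ultrapower A) (snd (fun_arity \<Sigma> f))"
    by (simp add: ultrapower_def)
next
  fix \<sigma> f g
  assume *: "\<sigma> \<in> sorts \<Sigma>" "f \<in> carrier (ultrapower A) \<sigma>" "g \<in> carrier (ultrapower A) \<sigma>"
  then have "\<forall>\<^sub>F i in U. f i \<in> carrier A \<sigma>" "\<forall>\<^sub>F i in U. g i \<in> carrier A \<sigma>"
    by (auto simp: carrier_ultrapower)
  then have "\<forall>\<^sub>F i in U. pred_interp A (eq_sym \<Sigma> \<sigma>) [f i, g i] \<longleftrightarrow> f i = g i"
    by eventually_elim (use assms *(1) in \<open>auto simp: is_structure_def\<close>)
  then have "pred_interp (ultrapower A) (eq_sym \<Sigma> \<sigma>) [f, g] \<longleftrightarrow> (\<forall>\<^sub>F i in U. f i = g i)"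
    by (simp add: ultrapower_def eventually_subst)
  also have "\<dots> \<longleftrightarrow> f = g"
  proof
    assume "\<forall>\<^sub>F i in U. f i = g i"
    then have "rep f = rep g" by (rule rep_cong)
    with * show "f = g" by (simp add: carrier_ultrapower)
  qed simp
  finally show "pred_interp (ultrapower A) (eq_sym \<Sigma> \<sigma>) [f, g] \<longleftrightarrow> f = g" .
qed

end

text \<open>Regularity of the ultrafilter: choosing at each finite set \<open>J\<close> an injection of
  \<open>J\<close> into an infinite carrier makes the images of distinct elements differ on all
  \<open>J\<close> containing both.\<close>

lemma (in ultrafilter) infinite_carrier_ultrapower:
  fixes A :: "('s, 'f, 'p, 'a) sorted_struct" and \<iota> :: "'i \<Rightarrow> 'k set"
  assumes "infinite (carrier A \<sigma>)" "filterlim \<iota> (finite_subsets_at_top UNIV) U"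
  shows "\<exists>e :: 'k \<Rightarrow> 'i \<Rightarrow> 'a. inj e \<and> range e \<subseteq> carrier (ultrapower A) \<sigma>"
proof -
  have "\<exists>h :: 'k \<Rightarrow> 'a. finite J \<longrightarrow> inj_on h J \<and> h ` J \<subseteq> carrier A \<sigma>" for J :: "'k set"
  proof (cases "finite J")
    case True
    obtain S where "finite S" "card S = card J" "S \<subseteq> carrier A \<sigma>"
      using infinite_arbitrarily_large[OF assms(1)] by metis
    with True obtain h where "bij_betw h J S"
      by (metis finite_same_card_bij)
    with \<open>S \<subseteq> _\<close> show ?thesis by (auto simp: bij_betw_def)
  qed simp
  then have "\<exists>h :: 'k set \<Rightarrow> 'k \<Rightarrow> 'a. \<forall>J. finite J \<longrightarrow> inj_on (h J) J \<and> h J ` J \<subseteq> carrier A \<sigma>"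
    by (intro choice allI)
  then obtain h :: "'k set \<Rightarrow> 'k \<Rightarrow> 'a"
    where h: "\<And>J. finite J \<Longrightarrow> inj_on (h J) J \<and> h J ` J \<subseteq> carrier A \<sigma>"
    by blast
  have ev: "\<forall>\<^sub>F i in U. finite (\<iota> i) \<and> X \<subseteq> \<iota> i" if "finite X" for X
    using assms(2) that by (auto simp: filterlim_finite_subsets_at_top)
  define e where "e k = rep (\<lambda>i. h (\<iota> i) k)" for k
  have e: "\<forall>\<^sub>F i in U. e k i = h (\<iota> i) k" for k
    unfolding e_def by (rule eventually_rep)
  have "inj e"
  proof (rule injI, rule ccontr)
    fix k k' assume *: "e k = e k'" "k \<noteq> k'"
    have "finite {k, k'}" by simp
    from ev[OF this] e[of k] e[of k'] have "\<forall>\<^sub>F i in U. False"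
    proof eventually_elim
      case (elim i)
      with h[of "\<iota> i"] * show False by (auto dest: inj_onD)
    qed
    then show False by (simp add: eventually_const_iff)
  qed
  moreover have "e k \<in> carrier (ultrapower A) \<sigma>" for k
  proof -
    have "finite {k}" by simp
    from ev[OF this] e[of k] have "\<forall>\<^sub>F i in U. e k i \<in> carrier A \<sigma>"
      by eventually_elim (use h in auto)
    then show ?thesis by (simp add: carrier_ultrapower) (simp add: e_def)
  qed
  ultimately show ?thesis by blast
qed

section \<open>Separation of blocks\<close>

primrec vars_trm :: "('s, 'f) trm \<Rightarrow> 's var set" where
  "vars_trm (Var x) = {x}"
| "vars_trm (App f ts) = \<Union> (set (map vars_trm ts))"

text \<open>Bound variables are included. This overestimates the free variables but keeps
  \<open>vars_sorts\<close> and \<open>sat_cong\<close> simple.\<close>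

primrec vars :: "('s, 'f, 'p) form \<Rightarrow> 's var set" where
  "vars (Atom p ts) = \<Union> (vars_trm ` set ts)"
| "vars (Neg \<phi>) = vars \<phi>"
| "vars (Conj \<phi> \<psi>) = vars \<phi> \<union> vars \<psi>"
| "vars (Exists x \<phi>) = insert x (vars \<phi>)"

lemma finite_vars_trm: "finite (vars_trm t)"
  by (induction t) auto

lemma finite_vars: "finite (vars \<phi>)"
  by (induction \<phi>) (auto simp: finite_vars_trm)

lemma vars_trm_sorts:
  assumes "is_signature \<Sigma>" "is_term \<Sigma> t"
  shows "snd ` vars_trm t \<subseteq> sorts \<Sigma>"
  using assms(2) by (induction t) (fastforce simp: list_all_iff)+

lemma vars_sorts:
  assumes "is_signature \<Sigma>" "is_formula \<Sigma> \<phi>"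
  shows "snd ` vars \<phi> \<subseteq> sorts \<Sigma>"
  using assms(2)
proof (induction \<phi>)
  case (Atom p ts)
  then have "snd ` vars_trm t \<subseteq> sorts \<Sigma>" if "t \<in> set ts" for t
    using vars_trm_sorts[OF assms(1)] that by (auto simp: list_all_iff)
  then show ?case by auto
qed auto

lemma eval_cong:
  assumes "\<And>x. x \<in> vars_trm t \<Longrightarrow> \<nu> x = \<nu>' x"
  shows "eval A \<nu> t = eval A \<nu>' t"
  using assms
proof (induction t)
  case (App f ts)
  have "map (eval A \<nu>) ts = map (eval A \<nu>') ts"
    by (rule map_cong[OF refl], rule App.IH) (use App.prems in auto)
  then show ?case by (simp only: eval.simps)
qed simp

lemma sat_cong:
  assumes "\<And>x. x \<in> vars \<phi> \<Longrightarrow> \<nu> x = \<nu>' x"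
  shows "sat A \<nu> \<phi> \<longleftrightarrow> sat A \<nu>' \<phi>"
  using assms
proof (induction \<phi> arbitrary: \<nu> \<nu>')
  case (Atom p ts)
  have "map (eval A \<nu>) ts = map (eval A \<nu>') ts"
    by (rule map_cong[OF refl], rule eval_cong) (use Atom in auto)
  then show ?case by (simp only: sat.simps)
next
  case (Neg \<phi>)
  from Neg.IH[of \<nu> \<nu>'] Neg.prems show ?case by simp
next
  case (Conj \<phi> \<psi>)
  from Conj.IH[of \<nu> \<nu>'] Conj.prems show ?case by simp
next
  case (Exists x \<phi>)
  have "sat A (\<nu>(x := a)) \<phi> \<longleftrightarrow> sat A (\<nu>'(x := a)) \<phi>" for a
    by (rule Exists.IH) (use Exists.prems in auto)
  then show ?case by simp
qed

lemma sort_in_block_unique: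
  assumes "split_by \<Sigma> \<Lambda> \<Sigma>s" "l \<in> \<Lambda>" "l' \<in> \<Lambda>" "\<sigma> \<in> l" "\<sigma> \<in> l'"
  shows "l = l'"
  using assms by (auto simp: split_by_def partition_on_def disjoint_def)

text \<open>The root symbol belongs to some \<open>\<Sigma>s l'\<close>, whose arities stay inside
  \<open>l'\<close>. The result sort forces \<open>l' = l\<close>, so every argument has its sort in
  \<open>l\<close> as well: a term never leaves the block of its sort.\<close>

lemma is_term_block:
  assumes "split_by \<Sigma> \<Lambda> \<Sigma>s" "l \<in> \<Lambda>" "is_signature \<Sigma>"
  shows "is_term \<Sigma> t \<Longrightarrow> sort_of \<Sigma> t \<in> l \<Longrightarrow> is_term (\<Sigma>s l) t \<and> sort_of (\<Sigma>s l) t = sort_of \<Sigma> t"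
proof (induction t)
  case (Var x)
  with assms show ?case by (auto simp: split_by_def)
next
  case (App f ts)
  from App.prems obtain l' where l': "l' \<in> \<Lambda>" "f \<in> funs (\<Sigma>s l')"
    using assms(1) by (auto simp: split_by_def)
  then have ar: "fun_arity (\<Sigma>s l') f = fun_arity \<Sigma> f" "is_signature (\<Sigma>s l')" "sorts (\<Sigma>s l') = l'"
    using assms(1) by (auto simp: split_by_def)
  with l' have "snd (fun_arity \<Sigma> f) \<in> l'" "set (fst (fun_arity \<Sigma> f)) \<subseteq> l'"
    unfolding is_signature_def by metis+
  moreover from this App.prems have "l' = l"
    using sort_in_block_unique[OF assms(1) l'(1) assms(2)] by simp
  ultimately have "set (map (sort_of \<Sigma>) ts) \<subseteq> l"
    using App.prems by (simp del: set_map)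
  then have "is_term (\<Sigma>s l) t \<and> sort_of (\<Sigma>s l) t = sort_of \<Sigma> t" if "t \<in> set ts" for t
    using App.IH[OF that] App.prems that by (auto simp: list_all_iff)
  then have "list_all (is_term (\<Sigma>s l)) ts" "map (sort_of (\<Sigma>s l)) ts = map (sort_of \<Sigma>) ts"
    by (auto simp: list_all_iff)
  then show ?case
    using App.prems ar l' \<open>l' = l\<close> by (simp del: map_eq_conv)
qed

text \<open>The empty disjunction needs a false formula, which every signature provides as a
  contradiction built from an equation. That case also supplies the constant formula for foreign
  atoms in \<open>block_separation\<close>.\<close>

lemma finite_disjunction:
  fixes A :: "('s, 'f, 'p, 'a) sorted_struct"
  assumes "is_signature \<Sigma>" "finite F" "\<forall>\<psi>\<in>F. is_formula \<Sigma> \<psi>"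
  shows "\<exists>\<psi>. is_formula \<Sigma> \<psi> \<and> (\<forall>\<nu>. sat A \<nu> \<psi> \<longleftrightarrow> (\<exists>\<chi>\<in>F. sat A \<nu> \<chi>))"
  using assms(2,3)
proof (induction F)
  case empty
  obtain \<sigma> where \<sigma>: "\<sigma> \<in> sorts \<Sigma>"
    using assms(1) by (auto simp: is_signature_def)
  let ?e = "Atom (eq_sym \<Sigma> \<sigma>) [Var (0, \<sigma>), Var (0, \<sigma>)] :: ('s, 'f, 'p) form"
  have "is_formula \<Sigma> (Conj ?e (Neg ?e))"
    using assms(1) \<sigma> by (auto simp: is_signature_def)
  then show ?case by (intro exI[of _ "Conj ?e (Neg ?e)"]) simp
next
  case (insert \<chi> F)
  then obtain \<psi> where "is_formula \<Sigma> \<psi>" "\<forall>\<nu>. sat A \<nu> \<psi> \<longleftrightarrow> (\<exists>\<chi>\<in>F. sat A \<nu> \<chi>)"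
    by auto
  with insert.prems show ?case
    by (intro exI[of _ "Neg (Conj (Neg \<chi>) (Neg \<psi>))"]) auto
qed

definition agree_off :: "'s set \<Rightarrow> ('s var \<Rightarrow> 'a) \<Rightarrow> ('s var \<Rightarrow> 'a) \<Rightarrow> bool" where
  "agree_off l \<nu> \<mu> \<longleftrightarrow> (\<forall>x. snd x \<notin> l \<longrightarrow> \<nu> x = \<mu> x)"

text \<open>The existential quantifier over a sort outside the block ranges over an infinite
  disjunction, which is finite up to equivalence because the witnesses of the induction
  hypothesis come from the finite set \<open>F\<close>; hence the finiteness of \<open>F\<close>, uniformly in
  \<open>\<mu>\<close>.\<close>

lemma block_separation:
  fixes A :: "('s, 'f, 'p, 'a) sorted_struct"
  assumes split: "split_by \<Sigma> \<Lambda> \<Sigma>s" "l \<in> \<Lambda>" and sig: "is_signature \<Sigma>"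
  shows "is_formula \<Sigma> \<phi> \<Longrightarrow>
    \<exists>F. finite F \<and> (\<forall>\<psi>\<in>F. is_formula (\<Sigma>s l) \<psi>) \<and>
      (\<forall>\<mu>. \<exists>\<psi>\<in>F. \<forall>\<nu>. agree_off l \<nu> \<mu> \<longrightarrow> (sat A \<nu> \<phi> \<longleftrightarrow> sat A \<nu> \<psi>))"
proof (induction \<phi>)
  case (Atom p ts)
  from Atom obtain l' where l': "l' \<in> \<Lambda>" "p \<in> preds (\<Sigma>s l')"
    using split(1) by (auto simp: split_by_def)
  then have ar: "pred_arity (\<Sigma>s l') p = pred_arity \<Sigma> p" "is_signature (\<Sigma>s l')" "sorts (\<Sigma>s l') = l'"
    using split(1) by (auto simp: split_by_def)
  with l' have "set (pred_arity \<Sigma> p) \<subseteq> l'"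
    unfolding is_signature_def by metis
  then have "set (map (sort_of \<Sigma>) ts) \<subseteq> l'"
    using Atom by (simp del: set_map)
  then have "is_term (\<Sigma>s l') t \<and> sort_of (\<Sigma>s l') t = sort_of \<Sigma> t" if "t \<in> set ts" for t
    using is_term_block[OF split(1) l'(1) sig, of t] Atom.prems that by (auto simp: list_all_iff)
  then have "list_all (is_term (\<Sigma>s l')) ts" "map (sort_of (\<Sigma>s l')) ts = map (sort_of \<Sigma>) ts"
    by (auto simp: list_all_iff)
  then have form: "is_formula (\<Sigma>s l') (Atom p ts)"
    using Atom.prems ar l' by (simp del: map_eq_conv)
  show ?case
  proof (cases "l' = l")
    case True
    with form show ?thesis by (intro exI[of _ "{Atom p ts}"]) simp
  next
    case False
    have off: "snd x \<notin> l" if "x \<in> vars (Atom p ts)" for x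
      using vars_sorts[OF ar(2) form] that ar(3) False sort_in_block_unique[OF split(1) l'(1) split(2)]
      by blast
    have sl: "is_signature (\<Sigma>s l)"
      using split by (auto simp: split_by_def)
    \<comment> \<open>The truth value of an atom from another block is fixed by
      \<open>\<mu>\<close>; a false formula and its negation represent the two values.\<close>
    obtain b where b: "is_formula (\<Sigma>s l) b" "\<And>\<nu>. \<not> sat A \<nu> b"
      using finite_disjunction[OF sl, of "{}" A] by auto
    have "\<exists>\<psi>\<in>{b, Neg b}. \<forall>\<nu>. agree_off l \<nu> \<mu> \<longrightarrow> (sat A \<nu> (Atom p ts) \<longleftrightarrow> sat A \<nu> \<psi>)"
      for \<mu> :: "'s var \<Rightarrow> 'a"
    proof -
      have "sat A \<nu> (Atom p ts) \<longleftrightarrow> sat A \<mu> (Atom p ts)" if "agree_off l \<nu> \<mu>" for \<nu>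
        by (rule sat_cong) (use off that in \<open>unfold agree_off_def, blast\<close>)
      then show ?thesis
        using b(2) unfolding bex_simps sat.simps(2) by blast
    qed
    with b show ?thesis by (intro exI[of _ "{b, Neg b}"]) auto
  qed
next
  case (Neg \<phi>)
  then obtain F where F: "finite F" "\<forall>\<psi>\<in>F. is_formula (\<Sigma>s l) \<psi>"
    "\<forall>\<mu>. \<exists>\<psi>\<in>F. \<forall>\<nu>. agree_off l \<nu> \<mu> \<longrightarrow> (sat A \<nu> \<phi> \<longleftrightarrow> sat A \<nu> \<psi>)"
    by auto
  show ?case
  proof (intro exI[of _ "Neg ` F"] conjI allI)
    fix \<mu> :: "'s var \<Rightarrow> 'a"
    obtain \<psi> where "\<psi> \<in> F" "\<forall>\<nu>. agree_off l \<nu> \<mu> \<longrightarrow> (sat A \<nu> \<phi> \<longleftrightarrow> sat A \<nu> \<psi>)"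
      using F(3) by blast
    then show "\<exists>\<psi>\<in>Neg ` F. \<forall>\<nu>. agree_off l \<nu> \<mu> \<longrightarrow> (sat A \<nu> (Neg \<phi>) \<longleftrightarrow> sat A \<nu> \<psi>)"
      by (intro bexI[of _ "Neg \<psi>"]) auto
  qed (use F in auto)
next
  case (Conj \<phi>1 \<phi>2)
  then obtain F1 F2 where F: "finite F1" "\<forall>\<psi>\<in>F1. is_formula (\<Sigma>s l) \<psi>"
    "\<forall>\<mu>. \<exists>\<psi>\<in>F1. \<forall>\<nu>. agree_off l \<nu> \<mu> \<longrightarrow> (sat A \<nu> \<phi>1 \<longleftrightarrow> sat A \<nu> \<psi>)"
    "finite F2" "\<forall>\<psi>\<in>F2. is_formula (\<Sigma>s l) \<psi>"
    "\<forall>\<mu>. \<exists>\<psi>\<in>F2. \<forall>\<nu>. agree_off l \<nu> \<mu> \<longrightarrow> (sat A \<nu> \<phi>2 \<longleftrightarrow> sat A \<nu> \<psi>)"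
    by auto
  let ?F = "(\<lambda>(\<psi>1, \<psi>2). Conj \<psi>1 \<psi>2) ` (F1 \<times> F2)"
  show ?case
  proof (intro exI[of _ ?F] conjI allI)
    fix \<mu> :: "'s var \<Rightarrow> 'a"
    obtain \<psi>1 where 1: "\<psi>1 \<in> F1" "\<forall>\<nu>. agree_off l \<nu> \<mu> \<longrightarrow> (sat A \<nu> \<phi>1 \<longleftrightarrow> sat A \<nu> \<psi>1)"
      using F(3) by blast
    obtain \<psi>2 where 2: "\<psi>2 \<in> F2" "\<forall>\<nu>. agree_off l \<nu> \<mu> \<longrightarrow> (sat A \<nu> \<phi>2 \<longleftrightarrow> sat A \<nu> \<psi>2)"
      using F(6) by blast
    show "\<exists>\<psi>\<in>?F. \<forall>\<nu>. agree_off l \<nu> \<mu> \<longrightarrow> (sat A \<nu> (Conj \<phi>1 \<phi>2) \<longleftrightarrow> sat A \<nu> \<psi>)"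
      by (rule bexI[of _ "Conj \<psi>1 \<psi>2"]) (use 1 2 in auto)
  qed (use F in auto)
next
  case (Exists x \<phi>)
  then obtain F where F: "finite F" "\<And>\<psi>. \<psi> \<in> F \<Longrightarrow> is_formula (\<Sigma>s l) \<psi>"
    "\<And>\<mu>. \<exists>\<psi>\<in>F. \<forall>\<nu>. agree_off l \<nu> \<mu> \<longrightarrow> (sat A \<nu> \<phi> \<longleftrightarrow> sat A \<nu> \<psi>)"
    by auto
  have sl: "is_signature (\<Sigma>s l)" "sorts (\<Sigma>s l) = l"
    using split by (auto simp: split_by_def)
  show ?case
  proof (cases "snd x \<in> l")
    case True
    show ?thesis
    proof (intro exI[of _ "Exists x ` F"] conjI allI)
      fix \<mu> :: "'s var \<Rightarrow> 'a"
      obtain \<psi> where \<psi>: "\<psi> \<in> F"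
        "\<And>\<nu>. agree_off l \<nu> \<mu> \<Longrightarrow> (sat A \<nu> \<phi> \<longleftrightarrow> sat A \<nu> \<psi>)"
        using F(3)[of \<mu>] by blast
      have "sat A (\<nu>(x := a)) \<phi> \<longleftrightarrow> sat A (\<nu>(x := a)) \<psi>" if "agree_off l \<nu> \<mu>" for \<nu> a
        by (rule \<psi>(2)) (use that True in \<open>auto simp: agree_off_def\<close>)
      then show "\<exists>\<psi>\<in>Exists x ` F. \<forall>\<nu>. agree_off l \<nu> \<mu> \<longrightarrow>
          (sat A \<nu> (Exists x \<phi>) \<longleftrightarrow> sat A \<nu> \<psi>)"
        using \<psi>(1) by (intro bexI[of _ "Exists x \<psi>"]) simp_all
    qed (use F True sl in auto)
  next
    case False
    \<comment> \<open>Which members of \<open>F\<close> are needed depends on \<open>\<mu>\<close>,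
      but they always form a subset of \<open>F\<close>; one disjunction per subset gives a finite
      set that serves every \<open>\<mu>\<close>.\<close>
    have "\<exists>d. is_formula (\<Sigma>s l) d \<and> (\<forall>\<nu>. sat A \<nu> d \<longleftrightarrow> (\<exists>\<psi>\<in>S. sat A \<nu> \<psi>))" if "S \<subseteq> F" for S
      using finite_disjunction[OF sl(1), of S A] that F(1,2) finite_subset by blast
    then obtain d where d: "\<And>S. S \<subseteq> F \<Longrightarrow> is_formula (\<Sigma>s l) (d S)"
      "\<And>S \<nu>. S \<subseteq> F \<Longrightarrow> sat A \<nu> (d S) \<longleftrightarrow> (\<exists>\<psi>\<in>S. sat A \<nu> \<psi>)"
      by metis
    show ?thesis
    proof (intro exI[of _ "d ` Pow F"] conjI allI)
      fix \<mu> :: "'s var \<Rightarrow> 'a"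
      have "\<exists>\<psi>\<in>F. \<forall>\<nu>. agree_off l \<nu> (\<mu>(x := a)) \<longrightarrow> (sat A \<nu> \<phi> \<longleftrightarrow> sat A \<nu> \<psi>)" for a
        by (rule F(3))
      then obtain \<psi> where \<psi>: "\<And>a. \<psi> a \<in> F"
        "\<And>a \<nu>. agree_off l \<nu> (\<mu>(x := a)) \<Longrightarrow> sat A \<nu> \<phi> \<longleftrightarrow> sat A \<nu> (\<psi> a)"
        by metis
      let ?S = "\<psi> ` carrier A (snd x)"
      have S: "?S \<subseteq> F" using \<psi>(1) by blast
      have "sat A (\<nu>(x := a)) \<phi> \<longleftrightarrow> sat A \<nu> (\<psi> a)" if "agree_off l \<nu> \<mu>" for \<nu> a
      proof -
        have "sat A (\<nu>(x := a)) \<phi> \<longleftrightarrow> sat A (\<nu>(x := a)) (\<psi> a)"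
          by (rule \<psi>(2)) (use that in \<open>auto simp: agree_off_def\<close>)
        \<comment> \<open>The sort of \<open>x\<close> lies outside \<open>l\<close>, so no formula
          of \<open>\<Sigma>s l\<close> mentions \<open>x\<close> and its value may be
          reset.\<close>
        also have "\<dots> \<longleftrightarrow> sat A \<nu> (\<psi> a)"
          by (rule sat_cong) (use vars_sorts[OF sl(1) F(2)[OF \<psi>(1)]] sl(2) False in auto)
        finally show ?thesis .
      qed
      then have "\<forall>\<nu>. agree_off l \<nu> \<mu> \<longrightarrow> (sat A \<nu> (Exists x \<phi>) \<longleftrightarrow> sat A \<nu> (d ?S))"
        unfolding d(2)[OF S] by simp
      then show "\<exists>\<psi>\<in>d ` Pow F. \<forall>\<nu>. agree_off l \<nu> \<mu> \<longrightarrow>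
          (sat A \<nu> (Exists x \<phi>) \<longleftrightarrow> sat A \<nu> \<psi>)"
        using S by blast
    qed (use F d in auto)
  qed
qed

section \<open>Skolem hulls\<close>

lemma card_of_finite_ordLeq:
  assumes "Cinfinite r" "finite A"
  shows "|A| \<le>o r"
proof -
  have "Cfinite |A|"
    using assms(2) by (simp add: cfinite_def Field_card_of card_of_card_order_on)
  then show ?thesis
    using Cfinite_ordLess_Cinfinite assms(1) ordLess_imp_ordLeq by blast
qed

lemma card_of_nat_ordLeq: "Cinfinite r \<Longrightarrow> |UNIV :: nat set| \<le>o r"
  using card_of_nat natLeq_ordLeq_cinfinite ordIso_ordLeq_trans by blast

lemma card_of_image_ordLeq: "|A| \<le>o r \<Longrightarrow> |f ` A| \<le>o r"
  by (rule ordLeq_transitive[OF card_of_image])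

lemma card_of_Times_ordLeq: "Cinfinite r \<Longrightarrow> |A| \<le>o r \<Longrightarrow> |B| \<le>o r \<Longrightarrow> |A \<times> B| \<le>o r"
  using card_of_Times_ordLeq_infinite_Field by (auto simp: cinfinite_def)

text \<open>Each length contributes a finite power of \<open>A\<close>, bounded since
  \<open>r\<close> absorbs products, and there are only countably many lengths.\<close>

lemma card_of_lists_ordLeq:
  assumes "Cinfinite r" "|A| \<le>o r"
  shows "|lists A| \<le>o r"
proof -
  have *: "|{xs \<in> lists A. length xs = n}| \<le>o r" for n
  proof (induction n)
    case 0
    have "{xs \<in> lists A. length xs = 0} = {[]}" by auto
    then show ?case
      using assms(1) by (simp add: card_of_finite_ordLeq)
  next
    case (Suc n)
    have "{xs \<in> lists A. length xs = Suc n} \<subseteq> (\<lambda>(x, xs). x # xs) ` (A \<times> {xs \<in> lists A. length xs = n})"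
      by (auto simp: length_Suc_conv image_iff)
    then have "|{xs \<in> lists A. length xs = Suc n}| \<le>o |A \<times> {xs \<in> lists A. length xs = n}|"
      by (rule ordLeq_transitive[OF card_of_mono1 card_of_image])
    also have "|A \<times> {xs \<in> lists A. length xs = n}| \<le>o r"
      using card_of_Times_ordLeq_infinite_Field assms Suc by (auto simp: cinfinite_def)
    finally show ?case .
  qed
  have "|UNIV :: nat set| \<le>o r"
    by (rule card_of_nat_ordLeq[OF assms(1)])
  then have "|\<Union>n. {xs \<in> lists A. length xs = n}| \<le>o r"
    using * assms(1) by (intro UNION_Cinfinite_bound) simp_all
  moreover have "(\<Union>n. {xs \<in> lists A. length xs = n}) = lists A" by auto
  ultimately show ?thesis by simp
qed

section \<open>Closure under operations on lists\<close>

primrec stage :: "('x list \<Rightarrow> 'x) set \<Rightarrow> 'x set \<Rightarrow> nat \<Rightarrow> 'x set" where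
  "stage Q X 0 = X"
| "stage Q X (Suc n) = stage Q X n \<union> (\<Union>q\<in>Q. q ` lists (stage Q X n))"

text \<open>Operations take lists of every length, so arities are ignored. The closure may grow by
  this, but its cardinal bound does not, and one construction serves for terms, formulas and Skolem
  functions alike.\<close>

definition generated :: "('x list \<Rightarrow> 'x) set \<Rightarrow> 'x set \<Rightarrow> 'x set" where
  "generated Q X = (\<Union>n. stage Q X n)"

lemma generated_base: "X \<subseteq> generated Q X"
  unfolding generated_def by (rule subset_trans[OF _ UN_upper[of 0]]) auto

lemma stage_mono: "m \<le> n \<Longrightarrow> stage Q X m \<subseteq> stage Q X n"
  by (rule lift_Suc_mono_le) auto

text \<open>A list has finitely many entries and the stages increase, so all entries already lie in
  one stage.\<close>

lemma generated_step:
  assumes "q \<in> Q" "set xs \<subseteq> generated Q X"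
  shows "q xs \<in> generated Q X"
proof -
  have "\<exists>n. set xs \<subseteq> stage Q X n"
    using assms(2)
  proof (induction xs)
    case (Cons x xs)
    then obtain m n where "x \<in> stage Q X m" "set xs \<subseteq> stage Q X n"
      by (auto simp: generated_def)
    then have "set (x # xs) \<subseteq> stage Q X (max m n)"
      using stage_mono[of m "max m n" Q X] stage_mono[of n "max m n" Q X] by auto
    then show ?case by blast
  qed simp
  then obtain n where "set xs \<subseteq> stage Q X n" by blast
  then have "q xs \<in> stage Q X (Suc n)"
    using assms(1) by auto
  then show ?thesis unfolding generated_def by blast
qed

lemma card_of_generated:
  assumes "Cinfinite r" "|Q| \<le>o r" "|X| \<le>o r"
  shows "|generated Q X| \<le>o r"
proof -
  have "|stage Q X n| \<le>o r" for n
  proof (induction n)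
    case (Suc n)
    then show ?case
      using assms by (auto intro!: Un_Cinfinite_bound UNION_Cinfinite_bound card_of_image_ordLeq
          card_of_lists_ordLeq)
  qed (simp add: assms)
  moreover have "|UNIV :: nat set| \<le>o r"
    by (rule card_of_nat_ordLeq[OF assms(1)])
  ultimately show ?thesis
    unfolding generated_def using assms(1) by (intro UNION_Cinfinite_bound) simp_all
qed

section \<open>Counting terms and formulas\<close>

lemma sig_card_ordLeqD:
  assumes "sig_card \<Sigma> \<le>o r"
  shows "|sorts \<Sigma>| \<le>o r" "|funs \<Sigma>| \<le>o r" "|preds \<Sigma>| \<le>o r"
proof -
  have 1: "|sorts \<Sigma>| +c |funs \<Sigma>| \<le>o sig_card \<Sigma>"
    unfolding sig_card_def by (rule ordLeq_csum1) (rule Card_order_csum)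
  have "|sorts \<Sigma>| \<le>o |sorts \<Sigma>| +c |funs \<Sigma>|"
    by (rule ordLeq_csum1[OF card_of_Card_order])
  then show "|sorts \<Sigma>| \<le>o r" by (rule ordLeq_transitive[OF _ ordLeq_transitive[OF 1 assms]])
  have "|funs \<Sigma>| \<le>o |sorts \<Sigma>| +c |funs \<Sigma>|"
    by (rule ordLeq_csum2[OF card_of_Card_order])
  then show "|funs \<Sigma>| \<le>o r" by (rule ordLeq_transitive[OF _ ordLeq_transitive[OF 1 assms]])
  have "|preds \<Sigma>| \<le>o sig_card \<Sigma>"
    unfolding sig_card_def by (rule ordLeq_csum2[OF card_of_Card_order])
  then show "|preds \<Sigma>| \<le>o r" by (rule ordLeq_transitive[OF _ assms])
qed

lemma card_of_vars:
  assumes "Cinfinite r" "|S| \<le>o r"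
  shows "|{x :: 's var. snd x \<in> S}| \<le>o r"
proof -
  have "|UNIV :: nat set| \<le>o r"
    by (rule card_of_nat_ordLeq[OF assms(1)])
  then have "|(UNIV :: nat set) \<times> S| \<le>o r"
    using assms by (intro card_of_Times_ordLeq)
  moreover have "{x :: 's var. snd x \<in> S} = UNIV \<times> S" by auto
  ultimately show ?thesis by simp
qed

lemma card_of_terms:
  assumes "Cinfinite r" "sig_card \<Sigma> \<le>o r"
  shows "|{t. is_term \<Sigma> t}| \<le>o r"
proof -
  \<comment> \<open>The closure also contains ill-sorted terms; only an upper bound is
    wanted.\<close>
  let ?Z = "generated (App ` funs \<Sigma>) (Var ` {x. snd x \<in> sorts \<Sigma>})"
  have "t \<in> ?Z" if "is_term \<Sigma> t" for t
    using that
  proof (induction t)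
    case (Var x)
    then show ?case using generated_base by fastforce
  next
    case (App f ts)
    then show ?case by (intro generated_step) (auto simp: list_all_iff)
  qed
  then have "{t. is_term \<Sigma> t} \<subseteq> ?Z" by blast
  moreover have "|?Z| \<le>o r"
    using assms sig_card_ordLeqD[OF assms(2)]
    by (intro card_of_generated card_of_image_ordLeq card_of_vars)
  ultimately show ?thesis by (rule ordLeq_transitive[OF card_of_mono1])
qed

lemma card_of_formulas:
  fixes \<Sigma> :: "('s, 'f, 'p) signature"
  assumes "Cinfinite r" "sig_card \<Sigma> \<le>o r"
  shows "|{\<phi>. is_formula \<Sigma> \<phi>}| \<le>o r"
proof -
  let ?X = "\<Union>p\<in>preds \<Sigma>. Atom p ` lists {t. is_term \<Sigma> t}"
  \<comment> \<open>Unary and binary constructors become list operations through \<open>hd\<close>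
    and \<open>last\<close>. Lists of other lengths only add incidental formulas to the
    closure.\<close>
  let ?Q = "{\<lambda>\<phi>s. Neg (hd \<phi>s), \<lambda>\<phi>s. Conj (hd \<phi>s) (last \<phi>s)} \<union>
    (\<lambda>x \<phi>s. Exists x (hd \<phi>s)) ` {x. snd x \<in> sorts \<Sigma>}
    :: (('s, 'f, 'p) form list \<Rightarrow> ('s, 'f, 'p) form) set"
  have "\<phi> \<in> generated ?Q ?X" if "is_formula \<Sigma> \<phi>" for \<phi>
    using that
  proof (induction \<phi>)
    case (Atom p ts)
    then have "Atom p ts \<in> ?X" by (auto simp: list_all_iff)
    then show ?case by (rule subsetD[OF generated_base])
  next
    case (Neg \<phi>)
    have "(\<lambda>\<phi>s. Neg (hd \<phi>s)) [\<phi>] \<in> generated ?Q ?X"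
      by (rule generated_step) (use Neg in simp_all)
    then show ?case by simp
  next
    case (Conj \<phi> \<psi>)
    have "(\<lambda>\<phi>s. Conj (hd \<phi>s) (last \<phi>s)) [\<phi>, \<psi>] \<in> generated ?Q ?X"
      by (rule generated_step) (use Conj in simp_all)
    then show ?case by simp
  next
    case (Exists x \<phi>)
    have "(\<lambda>\<phi>s. Exists x (hd \<phi>s)) [\<phi>] \<in> generated ?Q ?X"
      by (rule generated_step) (use Exists in simp_all)
    then show ?case by simp
  qed
  then have "{\<phi>. is_formula \<Sigma> \<phi>} \<subseteq> generated ?Q ?X" by (intro subsetI) simp
  moreover have "|generated ?Q ?X| \<le>o r"
  proof (rule card_of_generated[OF assms(1)])
    show "|?Q| \<le>o r"
      using assms(1) sig_card_ordLeqD[OF assms(2)]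
      by (intro Un_Cinfinite_bound[OF card_of_finite_ordLeq card_of_image_ordLeq[OF card_of_vars]]) simp_all
    show "|?X| \<le>o r"
      using assms sig_card_ordLeqD[OF assms(2)]
      by (intro UNION_Cinfinite_bound ballI card_of_image_ordLeq card_of_lists_ordLeq card_of_terms)
  qed
  ultimately show ?thesis by (rule ordLeq_transitive[OF card_of_mono1])
qed

text \<open>There is one Skolem function for each pair of a formula and a variable, fed with the
  values of the remaining variables. The set \<open>Z\<close> is unsorted; sorts are restored later
  by intersecting it with the carriers.\<close>

lemma skolem_hull:
  fixes M :: "('s, 'f, 'p, 'm) sorted_struct" and X :: "'m set"
  assumes r: "Cinfinite r" "sig_card \<Sigma> \<le>o r" and X: "|X| \<le>o r"
  obtains Z where "X \<subseteq> Z" "|Z| \<le>o r"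
    "\<And>f as. f \<in> funs \<Sigma> \<Longrightarrow> set as \<subseteq> Z \<Longrightarrow> fun_interp M f as \<in> Z"
    "\<And>\<psi> x \<nu>. is_formula \<Sigma> (Exists x \<psi>) \<Longrightarrow> \<nu> ` (vars \<psi> - {x}) \<subseteq> Z \<Longrightarrow> sat M \<nu> (Exists x \<psi>) \<Longrightarrow>
      \<exists>b\<in>Z \<inter> carrier M (snd x). sat M (\<nu>(x := b)) \<psi>"
proof -
  \<comment> \<open>A fixed enumeration of the parameters, so that a list of values determines the
    relevant part of an assignment.\<close>
  define vs where "vs \<psi> x = (SOME vs. set vs = vars \<psi> - {x})" for \<psi> :: "('s, 'f, 'p) form" and x
  have vs: "set (vs \<psi> x) = vars \<psi> - {x}" for \<psi> x
    unfolding vs_def by (rule someI_ex) (simp add: finite_list finite_vars)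
  \<comment> \<open>Variables without a value receive the unspecified \<open>the None\<close>. On
    argument lists of the right length the only such variable that can occur in
    \<open>\<psi>\<close> is \<open>x\<close>, which is overwritten.\<close>
  define w where "w = (\<lambda>(\<psi>, x) as. SOME b. b \<in> carrier M (snd x) \<and>
    sat M ((\<lambda>v. the (map_of (zip (vs \<psi> x) as) v))(x := b)) \<psi>)"
  let ?Q = "fun_interp M ` funs \<Sigma> \<union> w ` ({\<psi>. is_formula \<Sigma> \<psi>} \<times> {x. snd x \<in> sorts \<Sigma>})"
  let ?Z = "generated ?Q X"
  show thesis
  proof
    show "X \<subseteq> ?Z" by (rule generated_base)
    show "|?Z| \<le>o r"
      using r X sig_card_ordLeqD[OF r(2)]
      by (intro card_of_generated Un_Cinfinite_bound card_of_image_ordLeq card_of_Times_ordLeq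
          card_of_formulas card_of_vars)
    show "fun_interp M f as \<in> ?Z" if "f \<in> funs \<Sigma>" "set as \<subseteq> ?Z" for f as
      by (rule generated_step) (use that in auto)
    fix \<psi> x \<nu>
    assume *: "is_formula \<Sigma> (Exists x \<psi>)" "\<nu> ` (vars \<psi> - {x}) \<subseteq> ?Z" "sat M \<nu> (Exists x \<psi>)"
    let ?as = "map \<nu> (vs \<psi> x)"
    have eq: "sat M ((\<lambda>v. the (map_of (zip (vs \<psi> x) ?as) v))(x := b)) \<psi> \<longleftrightarrow> sat M (\<nu>(x := b)) \<psi>" for b
      by (rule sat_cong) (auto simp: map_of_zip_map vs)
    from *(3) have "\<exists>b. b \<in> carrier M (snd x) \<and> sat M (\<nu>(x := b)) \<psi>"
      by (simp add: Bex_def)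
    then have b: "w (\<psi>, x) ?as \<in> carrier M (snd x) \<and> sat M (\<nu>(x := w (\<psi>, x) ?as)) \<psi>"
      unfolding w_def prod.case eq by (rule someI_ex)
    have "w (\<psi>, x) ?as \<in> ?Z"
      by (rule generated_step) (use *(1,2) vs in auto)
    with b show "\<exists>b\<in>?Z \<inter> carrier M (snd x). sat M (\<nu>(x := b)) \<psi>" by blast
  qed
qed

section \<open>Tarski-Vaught test and hulls in blocks\<close>

lemma eval_update_carrier: "eval (M\<lparr>carrier := B\<rparr>) \<nu> t = eval M \<nu> t"
proof (induction t)
  case (App f ts)
  have "eval (M\<lparr>carrier := B\<rparr>) \<nu> (App f ts) = fun_interp M f (map (eval (M\<lparr>carrier := B\<rparr>) \<nu>) ts)"
    by simp
  also have "map (eval (M\<lparr>carrier := B\<rparr>) \<nu>) ts = map (eval M \<nu>) ts"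
    using App by simp
  finally show ?case by simp
qed simp

text \<open>The small structure keeps the interpretations of \<open>M\<close>, so atoms agree
  outright; only a quantifier can tell the two apart, and the test supplies its witness inside
  \<open>B\<close>.\<close>

lemma tarski_vaught:
  fixes M :: "('s, 'f, 'p, 'm) sorted_struct"
  assumes B: "\<And>\<sigma>. \<sigma> \<in> sorts \<Sigma> \<Longrightarrow> B \<sigma> \<subseteq> carrier M \<sigma>"
    and test: "\<And>x \<phi> \<nu>. is_formula \<Sigma> (Exists x \<phi>) \<Longrightarrow> is_assignment \<Sigma> (M\<lparr>carrier := B\<rparr>) \<nu> \<Longrightarrow>
      sat M \<nu> (Exists x \<phi>) \<Longrightarrow> \<exists>b\<in>B (snd x). sat M (\<nu>(x := b)) \<phi>"
  shows "is_formula \<Sigma> \<phi> \<Longrightarrow> is_assignment \<Sigma> (M\<lparr>carrier := B\<rparr>) \<nu> \<Longrightarrow>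
    sat (M\<lparr>carrier := B\<rparr>) \<nu> \<phi> \<longleftrightarrow> sat M \<nu> \<phi>"
proof (induction \<phi> arbitrary: \<nu>)
  case (Atom p ts)
  show ?case by (simp add: eval_update_carrier cong: map_cong)
next
  case (Exists x \<phi>)
  have IH: "sat (M\<lparr>carrier := B\<rparr>) (\<nu>(x := b)) \<phi> \<longleftrightarrow> sat M (\<nu>(x := b)) \<phi>" if "b \<in> B (snd x)" for b
    by (rule Exists.IH) (use Exists.prems that in \<open>auto simp: is_assignment_def\<close>)
  have "sat (M\<lparr>carrier := B\<rparr>) \<nu> (Exists x \<phi>) \<longleftrightarrow> (\<exists>b\<in>B (snd x). sat M (\<nu>(x := b)) \<phi>)"
    using IH by auto
  also have "\<dots> \<longleftrightarrow> sat M \<nu> (Exists x \<phi>)"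
  proof
    assume "\<exists>b\<in>B (snd x). sat M (\<nu>(x := b)) \<phi>"
    then show "sat M \<nu> (Exists x \<phi>)"
      using B[of "snd x"] Exists.prems(1) unfolding sat.simps is_formula.simps by blast
  qed (rule test[OF Exists.prems])
  finally show ?case .
qed simp_all

text \<open>No symbol crosses blocks, so closing each block under its own functions already yields a
  structure; \<open>ne\<close> keeps every sort inhabited. Through the seeds \<open>X l\<close>,
  chosen elements can be forced into the sorts.\<close>

lemma block_hull:
  fixes M :: "('s, 'f, 'p, 'm) sorted_struct" and X :: "'s set \<Rightarrow> 'm set" and \<kappa> :: "'s set \<Rightarrow> 'k rel"
  assumes sig: "is_signature \<Sigma>" and split: "split_by \<Sigma> \<Lambda> \<Sigma>s" and M: "is_structure \<Sigma> M"
    and \<kappa>: "\<And>l. l \<in> \<Lambda> \<Longrightarrow> Cinfinite (\<kappa> l)" "\<And>l. l \<in> \<Lambda> \<Longrightarrow> sig_card (\<Sigma>s l) \<le>o \<kappa> l"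
    and X: "\<And>l. l \<in> \<Lambda> \<Longrightarrow> |X l| \<le>o \<kappa> l"
    and ne: "\<And>l \<sigma>. l \<in> \<Lambda> \<Longrightarrow> \<sigma> \<in> l \<Longrightarrow> X l \<inter> carrier M \<sigma> \<noteq> {}"
  obtains B where
    "\<And>l \<sigma>. l \<in> \<Lambda> \<Longrightarrow> \<sigma> \<in> l \<Longrightarrow> X l \<inter> carrier M \<sigma> \<subseteq> B \<sigma> \<and> |B \<sigma>| \<le>o \<kappa> l"
    "elementary_substructure \<Sigma> (M\<lparr>carrier := B\<rparr>) M"
proof -
  define hull where "hull l Z \<longleftrightarrow> X l \<subseteq> Z \<and> |Z| \<le>o \<kappa> l \<and>
      (\<forall>f as. f \<in> funs (\<Sigma>s l) \<longrightarrow> set as \<subseteq> Z \<longrightarrow> fun_interp M f as \<in> Z) \<and>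
      (\<forall>\<psi> x \<nu>. is_formula (\<Sigma>s l) (Exists x \<psi>) \<longrightarrow> \<nu> ` (vars \<psi> - {x}) \<subseteq> Z \<longrightarrow>
        sat M \<nu> (Exists x \<psi>) \<longrightarrow> (\<exists>b\<in>Z \<inter> carrier M (snd x). sat M (\<nu>(x := b)) \<psi>))" for l Z
  have "\<exists>Z. hull l Z" if "l \<in> \<Lambda>" for l
    by (rule skolem_hull[OF \<kappa>[OF that] X[OF that], where M = M], unfold hull_def) blast
  then obtain Z where Z: "\<And>l. l \<in> \<Lambda> \<Longrightarrow> hull l (Z l)" by metis
  define block where "block \<sigma> = (SOME l. l \<in> \<Lambda> \<and> \<sigma> \<in> l)" for \<sigma>
  have "l \<in> \<Lambda> \<Longrightarrow> \<sigma> \<in> l \<Longrightarrow> block \<sigma> \<in> \<Lambda> \<and> \<sigma> \<in> block \<sigma>" for l \<sigma>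
    unfolding block_def by (rule someI_ex) blast
  then have block: "l \<in> \<Lambda> \<Longrightarrow> \<sigma> \<in> l \<Longrightarrow> block \<sigma> = l" for l \<sigma>
    using sort_in_block_unique[OF split] by blast
  have sorts_block: "\<exists>l\<in>\<Lambda>. \<sigma> \<in> l" if "\<sigma> \<in> sorts \<Sigma>" for \<sigma>
    using split that by (auto simp: split_by_def partition_on_def)
  have block_sig: "is_signature (\<Sigma>s l)" "sorts (\<Sigma>s l) = l" if "l \<in> \<Lambda>" for l
    using split that by (auto simp: split_by_def)
  have block_sorts: "l \<subseteq> sorts \<Sigma>" if "l \<in> \<Lambda>" for l
    using split that by (auto simp: split_by_def partition_on_def)
  define B where "B \<sigma> = Z (block \<sigma>) \<inter> carrier M \<sigma>" for \<sigma>
  have XB: "X l \<inter> carrier M \<sigma> \<subseteq> B \<sigma>" "|B \<sigma>| \<le>o \<kappa> l" if "l \<in> \<Lambda>" "\<sigma> \<in> l" for l \<sigma>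
  proof -
    show "X l \<inter> carrier M \<sigma> \<subseteq> B \<sigma>"
      using Z[OF that(1)] block[OF that] by (auto simp: B_def hull_def)
    have "B \<sigma> \<subseteq> Z l" by (simp add: B_def block[OF that])
    moreover have "|Z l| \<le>o \<kappa> l" using Z[OF that(1)] by (simp add: hull_def)
    ultimately show "|B \<sigma>| \<le>o \<kappa> l"
      by (rule ordLeq_transitive[OF card_of_mono1])
  qed
  have upd: "carrier (M\<lparr>carrier := B\<rparr>) = B" "fun_interp (M\<lparr>carrier := B\<rparr>) = fun_interp M"
    "pred_interp (M\<lparr>carrier := B\<rparr>) = pred_interp M"
    by simp_all
  have struct: "is_structure \<Sigma> (M\<lparr>carrier := B\<rparr>)"
    unfolding is_structure_def upd
  proof (intro conjI ballI)
    fix \<sigma> assume "\<sigma> \<in> sorts \<Sigma>"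
    then show "B \<sigma> \<noteq> {}"
      using sorts_block ne XB(1) by blast
  next
    fix f as
    assume *: "f \<in> funs \<Sigma>" "as \<in> tuples (M\<lparr>carrier := B\<rparr>) (fst (fun_arity \<Sigma> f))"
    obtain l where l: "l \<in> \<Lambda>" "f \<in> funs (\<Sigma>s l)"
      using split *(1) by (auto simp: split_by_def)
    then have ar: "fun_arity (\<Sigma>s l) f = fun_arity \<Sigma> f"
      using split by (auto simp: split_by_def)
    then have sl: "set (fst (fun_arity \<Sigma> f)) \<subseteq> l" "snd (fun_arity \<Sigma> f) \<in> l"
      using block_sig[OF l(1)] l(2) unfolding is_signature_def by metis+
    from *(2) have "list_all2 (\<lambda>a \<sigma>. a \<in> Z (block \<sigma>) \<inter> carrier M \<sigma>) as (fst (fun_arity \<Sigma> f))"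
      by (simp add: tuples_iff B_def)
    then have "list_all2 (\<lambda>a \<sigma>. a \<in> Z l \<and> a \<in> carrier M \<sigma>) as (fst (fun_arity \<Sigma> f))"
      by (rule list.rel_mono_strong) (use block[OF l(1)] sl(1) in auto)
    then have "as \<in> tuples M (fst (fun_arity \<Sigma> f))" "set as \<subseteq> Z l"
      by (auto simp: tuples_iff list_all2_conv_all_nth in_set_conv_nth)
    then have "fun_interp M f as \<in> Z l" "fun_interp M f as \<in> carrier M (snd (fun_arity \<Sigma> f))"
      using Z[OF l(1)] l(2) M *(1) by (auto simp: hull_def is_structure_def)
    then show "fun_interp M f as \<in> B (snd (fun_arity \<Sigma> f))"
      by (simp add: B_def block[OF l(1) sl(2)])
  qed (use M in \<open>auto simp: is_structure_def B_def\<close>)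
  have sat: "sat (M\<lparr>carrier := B\<rparr>) \<nu> \<phi> \<longleftrightarrow> sat M \<nu> \<phi>"
    if "is_formula \<Sigma> \<phi>" "is_assignment \<Sigma> (M\<lparr>carrier := B\<rparr>) \<nu>" for \<phi> \<nu>
    using _ _ that
  proof (rule tarski_vaught)
    show "B \<sigma> \<subseteq> carrier M \<sigma>" for \<sigma>
      by (simp add: B_def)
    fix x \<phi> \<nu>
    assume *: "is_formula \<Sigma> (Exists x \<phi>)" "is_assignment \<Sigma> (M\<lparr>carrier := B\<rparr>) \<nu>"
      "sat M \<nu> (Exists x \<phi>)"
    obtain l where l: "l \<in> \<Lambda>" "snd x \<in> l"
      using sorts_block *(1) by auto
    from *(1) have "is_formula \<Sigma> \<phi>" by simp
    \<comment> \<open>The values of \<open>\<nu>\<close> outside the block are frozen, so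
      \<open>\<psi>\<close> may depend on \<open>\<nu>\<close>. This is harmless, since the hull has
      witnesses for every formula of the block.\<close>
    from block_separation[OF split l(1) sig this, of M] obtain \<psi>
      where \<psi>: "is_formula (\<Sigma>s l) \<psi>" "\<And>\<nu>'. agree_off l \<nu>' \<nu> \<Longrightarrow> sat M \<nu>' \<phi> \<longleftrightarrow> sat M \<nu>' \<psi>"
      by blast
    have eq: "sat M (\<nu>(x := b)) \<phi> \<longleftrightarrow> sat M (\<nu>(x := b)) \<psi>" for b
      by (rule \<psi>(2)) (use l(2) in \<open>auto simp: agree_off_def\<close>)
    \<comment> \<open>Every variable of \<open>\<psi>\<close> has its sort in \<open>l\<close>, so
      all parameters come from this one hull and none from the hull of another block.\<close>
    have "\<nu> v \<in> Z l" if "v \<in> vars \<psi>" for v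
    proof -
      have "snd v \<in> l"
        using vars_sorts[OF block_sig(1)[OF l(1)] \<psi>(1)] block_sig(2)[OF l(1)] that by auto
      then have "\<nu> v \<in> B (snd v)"
        using *(2) block_sorts[OF l(1)] by (cases v) (auto simp: is_assignment_def)
      with \<open>snd v \<in> l\<close> show ?thesis by (simp add: B_def block[OF l(1)])
    qed
    then have "\<nu> ` (vars \<psi> - {x}) \<subseteq> Z l" by blast
    moreover have "is_formula (\<Sigma>s l) (Exists x \<psi>)"
      using \<psi>(1) l block_sig by simp
    moreover have "sat M \<nu> (Exists x \<psi>)"
      using *(3) by (simp add: eq)
    ultimately have "\<exists>b\<in>Z l \<inter> carrier M (snd x). sat M (\<nu>(x := b)) \<psi>"
      using Z[OF l(1)] unfolding hull_def by blast
    then show "\<exists>b\<in>B (snd x). sat M (\<nu>(x := b)) \<phi>"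
      by (simp add: B_def block[OF l] eq)
  qed
  have "substructure \<Sigma> (M\<lparr>carrier := B\<rparr>) M"
    unfolding substructure_def upd using struct M by (simp add: B_def)
  with sat have "elementary_substructure \<Sigma> (M\<lparr>carrier := B\<rparr>) M"
    unfolding elementary_substructure_def by blast
  with XB show thesis
    by (rule that[OF conjI])
qed

section \<open>Sort-dependent renaming of elements\<close>

text \<open>In contrast to \<^const>\<open>copy\<close>, the renaming depends on the sort: the domains of
  distinct sorts may overlap.\<close>

definition transport ::
  "('s, 'f, 'p) signature \<Rightarrow> ('s \<Rightarrow> 'm \<Rightarrow> 'b) \<Rightarrow> ('s, 'f, 'p, 'm) sorted_struct \<Rightarrow>
    ('s, 'f, 'p, 'b) sorted_struct" where
  "transport \<Sigma> j M =
     (let back = map2 (\<lambda>\<sigma>. inv_into (carrier M \<sigma>) (j \<sigma>)) in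
     \<lparr>carrier = (\<lambda>\<sigma>. j \<sigma> ` carrier M \<sigma>),
      fun_interp = (\<lambda>f bs. j (snd (fun_arity \<Sigma> f)) (fun_interp M f (back (fst (fun_arity \<Sigma> f)) bs))),
      pred_interp = (\<lambda>p bs. pred_interp M p (back (pred_arity \<Sigma> p) bs))\<rparr>)"

locale sorted_renaming =
  fixes \<Sigma> :: "('s, 'f, 'p) signature" and j :: "'s \<Rightarrow> 'm \<Rightarrow> 'b" and M :: "('s, 'f, 'p, 'm) sorted_struct"
  assumes sig: "is_signature \<Sigma>" and struct: "is_structure \<Sigma> M"
    and inj: "\<And>\<sigma>. \<sigma> \<in> sorts \<Sigma> \<Longrightarrow> inj_on (j \<sigma>) (carrier M \<sigma>)"
begin

lemma carrier_transport [simp]: "carrier (transport \<Sigma> j M) \<sigma> = j \<sigma> ` carrier M \<sigma>"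
  by (simp add: transport_def)

lemma tuples_transport: "tuples (transport \<Sigma> j M) \<sigma>s = map2 j \<sigma>s ` tuples M \<sigma>s"
proof (induction \<sigma>s)
  case (Cons \<sigma> \<sigma>s)
  have *: "tuples C (\<sigma> # \<sigma>s) = (\<lambda>(a, as). a # as) ` (carrier C \<sigma> \<times> tuples C \<sigma>s)"
    for C :: "('s, 'f, 'p, 'x) sorted_struct" and \<sigma> \<sigma>s
    by (auto simp: tuples_def set_Cons_def)
  show ?case
    unfolding * Cons by (auto simp: image_iff)
qed (simp add: tuples_def)

lemma back_transport:
  assumes "set \<sigma>s \<subseteq> sorts \<Sigma>" "as \<in> tuples M \<sigma>s"
  shows "map2 (\<lambda>\<sigma>. inv_into (carrier M \<sigma>) (j \<sigma>)) \<sigma>s (map2 j \<sigma>s as) = as"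
  using assms(2,1) unfolding tuples_iff
  by (induction rule: list_all2_induct) (auto simp: inj)

lemma fun_interp_transport:
  assumes "f \<in> funs \<Sigma>" "as \<in> tuples M (fst (fun_arity \<Sigma> f))"
  shows "fun_interp (transport \<Sigma> j M) f (map2 j (fst (fun_arity \<Sigma> f)) as) =
    j (snd (fun_arity \<Sigma> f)) (fun_interp M f as)"
proof -
  have "set (fst (fun_arity \<Sigma> f)) \<subseteq> sorts \<Sigma>"
    using sig assms(1) by (auto simp: is_signature_def)
  from back_transport[OF this assms(2)] show ?thesis
    by (simp add: transport_def)
qed

lemma pred_interp_transport:
  assumes "p \<in> preds \<Sigma>" "as \<in> tuples M (pred_arity \<Sigma> p)"
  shows "pred_interp (transport \<Sigma> j M) p (map2 j (pred_arity \<Sigma> p) as) \<longleftrightarrow> pred_interp M p as"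
proof -
  have "set (pred_arity \<Sigma> p) \<subseteq> sorts \<Sigma>"
    using sig assms(1) by (auto simp: is_signature_def)
  from back_transport[OF this assms(2)] show ?thesis
    by (simp add: transport_def)
qed

lemma is_structure_transport: "is_structure \<Sigma> (transport \<Sigma> j M)"
  unfolding is_structure_def carrier_transport
proof (intro conjI ballI)
  fix \<sigma> assume "\<sigma> \<in> sorts \<Sigma>"
  then show "j \<sigma> ` carrier M \<sigma> \<noteq> {}"
    using struct by (auto simp: is_structure_def)
next
  fix f bs
  assume *: "f \<in> funs \<Sigma>" "bs \<in> tuples (transport \<Sigma> j M) (fst (fun_arity \<Sigma> f))"
  then obtain as where as: "bs = map2 j (fst (fun_arity \<Sigma> f)) as" "as \<in> tuples M (fst (fun_arity \<Sigma> f))"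
    by (auto simp: tuples_transport)
  have "fun_interp M f as \<in> carrier M (snd (fun_arity \<Sigma> f))"
    using struct *(1) as(2) by (auto simp: is_structure_def)
  then show "fun_interp (transport \<Sigma> j M) f bs \<in>
      j (snd (fun_arity \<Sigma> f)) ` carrier M (snd (fun_arity \<Sigma> f))"
    using fun_interp_transport[OF *(1) as(2)] as(1) by simp
next
  fix \<sigma> a b
  assume *: "\<sigma> \<in> sorts \<Sigma>" "a \<in> j \<sigma> ` carrier M \<sigma>" "b \<in> j \<sigma> ` carrier M \<sigma>"
  then obtain a' b' where ab: "a = j \<sigma> a'" "b = j \<sigma> b'" "a' \<in> carrier M \<sigma>" "b' \<in> carrier M \<sigma>"
    by blast
  have eq: "eq_sym \<Sigma> \<sigma> \<in> preds \<Sigma>" "pred_arity \<Sigma> (eq_sym \<Sigma> \<sigma>) = [\<sigma>, \<sigma>]"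
    using sig *(1) by (auto simp: is_signature_def)
  have "[a', b'] \<in> tuples M (pred_arity \<Sigma> (eq_sym \<Sigma> \<sigma>))"
    using ab eq by (simp add: tuples_iff)
  from pred_interp_transport[OF eq(1) this]
  have "pred_interp (transport \<Sigma> j M) (eq_sym \<Sigma> \<sigma>) [a, b] \<longleftrightarrow> pred_interp M (eq_sym \<Sigma> \<sigma>) [a', b']"
    by (simp add: eq ab)
  also have "\<dots> \<longleftrightarrow> a' = b'"
    using struct *(1) ab by (auto simp: is_structure_def)
  also have "\<dots> \<longleftrightarrow> a = b"
    using inj[OF *(1)] ab by (auto dest: inj_onD)
  finally show "pred_interp (transport \<Sigma> j M) (eq_sym \<Sigma> \<sigma>) [a, b] \<longleftrightarrow> a = b" .
qed

text \<open>Both halves go together: the renaming can be undone only on the carriers, so commutation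
  at \<open>App\<close> needs argument values of the right sorts.\<close>

lemma eval_transport:
  assumes "is_assignment \<Sigma> M \<nu>"
  shows "is_term \<Sigma> t \<Longrightarrow> eval M \<nu> t \<in> carrier M (sort_of \<Sigma> t) \<and>
    eval (transport \<Sigma> j M) (\<lambda>v. j (snd v) (\<nu> v)) t = j (sort_of \<Sigma> t) (eval M \<nu> t)"
proof (induction t)
  case (Var x)
  with assms show ?case by (cases x) (auto simp: is_assignment_def)
next
  case (App f ts)
  then have f: "f \<in> funs \<Sigma>" and ar: "fst (fun_arity \<Sigma> f) = map (sort_of \<Sigma>) ts" by auto
  have IH: "eval M \<nu> t \<in> carrier M (sort_of \<Sigma> t)"
    "eval (transport \<Sigma> j M) (\<lambda>v. j (snd v) (\<nu> v)) t = j (sort_of \<Sigma> t) (eval M \<nu> t)"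
    if "t \<in> set ts" for t
    using App.IH[OF that] App.prems that by (auto simp: list_all_iff)
  have tup: "map (eval M \<nu>) ts \<in> tuples M (fst (fun_arity \<Sigma> f))"
    unfolding ar tuples_iff using IH(1) by (simp add: list_all2_conv_all_nth)
  have "map (eval (transport \<Sigma> j M) (\<lambda>v. j (snd v) (\<nu> v))) ts =
      map2 j (fst (fun_arity \<Sigma> f)) (map (eval M \<nu>) ts)"
    unfolding ar map2_map_map using IH(2) by simp
  then have "eval (transport \<Sigma> j M) (\<lambda>v. j (snd v) (\<nu> v)) (App f ts) =
      j (snd (fun_arity \<Sigma> f)) (fun_interp M f (map (eval M \<nu>) ts))"
    using fun_interp_transport[OF f tup] by (simp only: eval.simps)
  moreover have "fun_interp M f (map (eval M \<nu>) ts) \<in> carrier M (snd (fun_arity \<Sigma> f))"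
    using struct f tup unfolding is_structure_def by blast
  ultimately show ?case by simp
qed

lemma sat_transport:
  "is_formula \<Sigma> \<phi> \<Longrightarrow> is_assignment \<Sigma> M \<nu> \<Longrightarrow>
    sat (transport \<Sigma> j M) (\<lambda>v. j (snd v) (\<nu> v)) \<phi> \<longleftrightarrow> sat M \<nu> \<phi>"
proof (induction \<phi> arbitrary: \<nu>)
  case (Atom p ts)
  then have p: "p \<in> preds \<Sigma>" and ar: "pred_arity \<Sigma> p = map (sort_of \<Sigma>) ts" by auto
  have ev: "eval M \<nu> t \<in> carrier M (sort_of \<Sigma> t)"
    "eval (transport \<Sigma> j M) (\<lambda>v. j (snd v) (\<nu> v)) t = j (sort_of \<Sigma> t) (eval M \<nu> t)"
    if "t \<in> set ts" for t
    using eval_transport[OF Atom.prems(2), of t] Atom.prems(1) that by (auto simp: list_all_iff)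
  have tup: "map (eval M \<nu>) ts \<in> tuples M (pred_arity \<Sigma> p)"
    unfolding ar tuples_iff using ev(1) by (simp add: list_all2_conv_all_nth)
  have "map (eval (transport \<Sigma> j M) (\<lambda>v. j (snd v) (\<nu> v))) ts =
      map2 j (pred_arity \<Sigma> p) (map (eval M \<nu>) ts)"
    unfolding ar map2_map_map using ev(2) by simp
  then show ?case
    using pred_interp_transport[OF p tup] by (simp only: sat.simps)
next
  case (Exists x \<phi>)
  have upd: "(\<lambda>v. j (snd v) (\<nu> v))(x := j (snd x) a) = (\<lambda>v. j (snd v) ((\<nu>(x := a)) v))" for a
    by (rule ext) simp
  have "sat (transport \<Sigma> j M) (\<lambda>v. j (snd v) ((\<nu>(x := a)) v)) \<phi> \<longleftrightarrow> sat M (\<nu>(x := a)) \<phi>"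
    if "a \<in> carrier M (snd x)" for a
    by (rule Exists.IH) (use Exists.prems that in \<open>auto simp: is_assignment_def\<close>)
  then show ?case
    unfolding sat.simps carrier_transport bex_simps upd by blast
qed simp_all

end

section \<open>Extensions with prescribed cardinalities\<close>

theorem theorem9:
  fixes \<Sigma> :: "('s, 'f, 'p) signature"
    and \<Lambda> :: "'s set set"
    and \<Sigma>s :: "'s set \<Rightarrow> ('s, 'f, 'p) signature"
    and A :: "('s, 'f, 'p, 'a) sorted_struct"
    and \<kappa> :: "'s set \<Rightarrow> 'k rel"
  assumes "is_signature \<Sigma>"
    and "split_by \<Sigma> \<Lambda> \<Sigma>s"
    and "is_structure \<Sigma> A"
    and "\<And>l. l \<in> \<Lambda> \<Longrightarrow> Card_order (\<kappa> l)"
    and "\<And>l. l \<in> \<Lambda> \<Longrightarrow> sig_card (\<Sigma>s l) \<le>o \<kappa> l"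
    and "\<And>l. l \<in> \<Lambda> \<Longrightarrow> natLeq \<le>o \<kappa> l"
    and "\<And>l \<sigma>. l \<in> \<Lambda> \<Longrightarrow> \<sigma> \<in> infinite_sorts \<Sigma> A \<inter> l \<Longrightarrow> |carrier A \<sigma>| \<le>o \<kappa> l"
  shows "\<exists>B :: ('s, 'f, 'p, 'a + 'k) sorted_struct.
           is_structure \<Sigma> B \<and>
           elementary_substructure \<Sigma> (copy Inl A) B \<and>
           (\<forall>l\<in>\<Lambda>. \<forall>\<sigma>\<in>infinite_sorts \<Sigma> A \<inter> l. |carrier B \<sigma>| =o \<kappa> l) \<and>
           (\<forall>\<sigma>\<in>finite_sorts \<Sigma> A. carrier B \<sigma> = carrier (copy Inl A) \<sigma>)"
proof -
  note sig = assms(1) and split = assms(2) and A = assms(3)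
  have \<kappa>: "Cinfinite (\<kappa> l)" if "l \<in> \<Lambda>" for l
    using cinfinite_mono[OF assms(6)[OF that] natLeq_cinfinite] assms(4)[OF that] by simp
  have block_sorts: "\<sigma> \<in> sorts \<Sigma>" if "l \<in> \<Lambda>" "\<sigma> \<in> l" for l \<sigma>
    using split that by (auto simp: split_by_def partition_on_def)
  have sorts_block: "\<exists>l\<in>\<Lambda>. \<sigma> \<in> l" if "\<sigma> \<in> sorts \<Sigma>" for \<sigma>
    using split that by (auto simp: split_by_def partition_on_def)
  have infinite_sorts: "\<sigma> \<in> infinite_sorts \<Sigma> A \<longleftrightarrow> \<sigma> \<in> sorts \<Sigma> \<and> infinite (carrier A \<sigma>)" for \<sigma>
    unfolding infinite_sorts_def mem_Collect_eq using infinite_iff_natLeq_ordLeq[of "carrier A \<sigma>"] by blast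

  obtain U :: "'k set filter" where U: "U \<le> finite_subsets_at_top UNIV" "ultrafilter U"
    by (rule ultrafilter_exists[OF finite_subsets_at_top_neq_bot])
  interpret ultrafilter U by (rule U(2))
  let ?M = "ultrapower A"
  let ?c = "\<lambda>(a :: 'a) (_ :: 'k set). a"
  have M: "is_structure \<Sigma> ?M"
    by (rule is_structure_ultrapower[OF A])
  have "filterlim (\<lambda>J. J) (finite_subsets_at_top UNIV) U"
    using U(1) by (simp add: filterlim_def)
  then have "\<exists>e :: 'k \<Rightarrow> 'k set \<Rightarrow> 'a. \<sigma> \<in> infinite_sorts \<Sigma> A \<longrightarrow> inj e \<and> range e \<subseteq> carrier ?M \<sigma>" for \<sigma>
    using infinite_carrier_ultrapower[of A \<sigma> "\<lambda>J. J"] infinite_sorts[of \<sigma>] by blast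
  then obtain e :: "'s \<Rightarrow> 'k \<Rightarrow> 'k set \<Rightarrow> 'a"
    where e: "\<And>\<sigma>. \<sigma> \<in> infinite_sorts \<Sigma> A \<Longrightarrow> inj (e \<sigma>) \<and> range (e \<sigma>) \<subseteq> carrier ?M \<sigma>"
    by metis

  \<comment> \<open>The constants put the image of \<open>A\<close> into the hull. Of the injected
    copy of \<open>'k\<close> only the part indexed by \<open>Field (\<kappa> l)\<close> is taken:
    enough to reach \<open>\<kappa> l\<close> elements, few enough not to exceed it.\<close>
  define X where "X l = (\<Union>\<sigma>\<in>l. ?c ` carrier A \<sigma>) \<union> (\<Union>\<sigma>\<in>infinite_sorts \<Sigma> A \<inter> l. e \<sigma> ` Field (\<kappa> l))" for l
  have card_block: "|l| \<le>o \<kappa> l" if "l \<in> \<Lambda>" for l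
    using sig_card_ordLeqD(1)[OF assms(5)[OF that]] split that by (auto simp: split_by_def)
  have card_X: "|X l| \<le>o \<kappa> l" if l: "l \<in> \<Lambda>" for l
  proof -
    have "|carrier A \<sigma>| \<le>o \<kappa> l" if "\<sigma> \<in> l" for \<sigma>
    proof (cases "\<sigma> \<in> infinite_sorts \<Sigma> A")
      case True
      with that show ?thesis by (intro assms(7)[OF l]) simp
    next
      case False
      then have "finite (carrier A \<sigma>)" using infinite_sorts block_sorts[OF l that] by blast
      then show ?thesis by (rule card_of_finite_ordLeq[OF \<kappa>[OF l]])
    qed
    moreover have "|infinite_sorts \<Sigma> A \<inter> l| \<le>o \<kappa> l"
      by (rule ordLeq_transitive[OF card_of_mono1 card_block[OF l]]) simp
    moreover have "|Field (\<kappa> l)| \<le>o \<kappa> l"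
      by (rule ordIso_imp_ordLeq[OF card_of_Field_ordIso[OF assms(4)[OF l]]])
    ultimately show ?thesis
      unfolding X_def using \<kappa>[OF l] card_block[OF l]
      by (intro Un_Cinfinite_bound UNION_Cinfinite_bound ballI card_of_image_ordLeq)
  qed
  have cX: "?c ` carrier A \<sigma> \<subseteq> X l \<inter> carrier ?M \<sigma>" if "\<sigma> \<in> l" for l \<sigma>
    using that by (auto simp: X_def)
  have ne: "X l \<inter> carrier ?M \<sigma> \<noteq> {}" if "l \<in> \<Lambda>" "\<sigma> \<in> l" for l \<sigma>
  proof -
    have "carrier A \<sigma> \<noteq> {}" using A block_sorts[OF that] by (simp add: is_structure_def)
    with cX[OF that(2)] show ?thesis by blast
  qed
  obtain B where B: "\<And>l \<sigma>. l \<in> \<Lambda> \<Longrightarrow> \<sigma> \<in> l \<Longrightarrow> X l \<inter> carrier ?M \<sigma> \<subseteq> B \<sigma> \<and> |B \<sigma>| \<le>o \<kappa> l"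
    and elem: "elementary_substructure \<Sigma> (?M\<lparr>carrier := B\<rparr>) ?M"
  proof (rule block_hull[OF sig split M \<kappa> assms(5) card_X ne])
    fix B
    assume "\<And>l \<sigma>. l \<in> \<Lambda> \<Longrightarrow> \<sigma> \<in> l \<Longrightarrow> X l \<inter> carrier ?M \<sigma> \<subseteq> B \<sigma> \<and> |B \<sigma>| \<le>o \<kappa> l"
      "elementary_substructure \<Sigma> (?M\<lparr>carrier := B\<rparr>) ?M"
    then show thesis by (rule that)
  qed
  have BM: "B \<sigma> \<subseteq> carrier ?M \<sigma>" if "\<sigma> \<in> sorts \<Sigma>" for \<sigma>
    using elem that by (simp add: elementary_substructure_def substructure_def)
  have N: "is_structure \<Sigma> (?M\<lparr>carrier := B\<rparr>)"
    using elem by (simp add: elementary_substructure_def substructure_def)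
  have cB: "?c ` carrier A \<sigma> \<subseteq> B \<sigma>" if "\<sigma> \<in> sorts \<Sigma>" for \<sigma>
    using sorts_block[OF that] cX B by blast
  \<comment> \<open>Squeezed between the constants, which are seeds, and the ultrapower, whose
    finite sorts contain nothing else.\<close>
  have B_finite: "B \<sigma> = ?c ` carrier A \<sigma>" if "\<sigma> \<in> sorts \<Sigma>" "\<sigma> \<notin> infinite_sorts \<Sigma> A" for \<sigma>
    using cB[OF that(1)] BM[OF that(1)] carrier_ultrapower_finite[of A \<sigma>] that infinite_sorts by blast
  have B_infinite: "|B \<sigma>| =o \<kappa> l" if "l \<in> \<Lambda>" "\<sigma> \<in> infinite_sorts \<Sigma> A \<inter> l" for l \<sigma>
  proof -
    have "e \<sigma> ` Field (\<kappa> l) \<subseteq> B \<sigma>"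
      using B[OF that(1)] e[of \<sigma>] that(2) unfolding X_def by blast
    then have "|Field (\<kappa> l)| \<le>o |B \<sigma>|"
      using e[of \<sigma>] that(2) card_of_ordLeq[of "Field (\<kappa> l)" "B \<sigma>"] inj_on_subset by blast
    then have "\<kappa> l \<le>o |B \<sigma>|"
      by (rule ordIso_ordLeq_trans[OF ordIso_symmetric[OF card_of_Field_ordIso[OF assms(4)[OF that(1)]]]])
    then show ?thesis
      using B[OF that(1)] that(2) by (simp add: ordIso_iff_ordLeq)
  qed

  \<comment> \<open>An infinite sort has size \<open>\<kappa> l\<close>, a cardinal on
    \<open>'k\<close>, so its new elements fit into \<open>'k\<close>; a finite sort has no new
    elements. Sending constants to \<open>Inl\<close> makes the result extend
    \<open>copy Inl A\<close> literally.\<close>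
  have "\<exists>j :: ('k set \<Rightarrow> 'a) \<Rightarrow> 'a + 'k. \<sigma> \<in> sorts \<Sigma> \<longrightarrow> inj_on j (B \<sigma>) \<and> (\<forall>a. j (?c a) = Inl a)" for \<sigma>
  proof (cases "\<sigma> \<in> sorts \<Sigma>")
    case True
    have "\<exists>r :: ('k set \<Rightarrow> 'a) \<Rightarrow> 'k. inj_on r (B \<sigma> - range ?c)"
    proof (cases "\<sigma> \<in> infinite_sorts \<Sigma> A")
      case inf: True
      obtain l where l: "l \<in> \<Lambda>" "\<sigma> \<in> l" using sorts_block[OF True] by blast
      with inf have "|B \<sigma>| =o |Field (\<kappa> l)|"
        using ordIso_transitive[OF B_infinite ordIso_symmetric[OF card_of_Field_ordIso[OF assms(4)[OF l(1)]]]]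
        by blast
      then obtain r :: "('k set \<Rightarrow> 'a) \<Rightarrow> 'k" where "inj_on r (B \<sigma>)"
        using card_of_ordIso[of "B \<sigma>" "Field (\<kappa> l)"] by (auto simp: bij_betw_def)
      then show ?thesis by (blast intro: inj_on_subset)
    next
      case False
      with B_finite[OF True] have "B \<sigma> - range ?c = {}" by blast
      then show ?thesis by (simp only: inj_on_empty simp_thms)
    qed
    then obtain r :: "('k set \<Rightarrow> 'a) \<Rightarrow> 'k" where r: "inj_on r (B \<sigma> - range ?c)" by blast
    \<comment> \<open>A constant function is decoded by evaluating it at the arbitrary index
      \<open>{}\<close>.\<close>
    define j where "j f = (if f \<in> range ?c then Inl (f {}) else Inr (r f))" for f
    have "inj_on j (B \<sigma>)"
      using r by (auto simp: inj_on_def j_def split: if_splits)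
    moreover have "j (?c a) = Inl a" for a
      by (auto simp: j_def)
    ultimately show ?thesis by blast
  qed simp
  then obtain j :: "'s \<Rightarrow> ('k set \<Rightarrow> 'a) \<Rightarrow> 'a + 'k"
    where j: "\<And>\<sigma>. \<sigma> \<in> sorts \<Sigma> \<Longrightarrow> inj_on (j \<sigma>) (B \<sigma>) \<and> (\<forall>a. j \<sigma> (?c a) = Inl a)"
    by metis
  let ?N = "?M\<lparr>carrier := B\<rparr>"
  have upd: "carrier ?N = B" "fun_interp ?N = fun_interp ?M" "pred_interp ?N = pred_interp ?M"
    by simp_all
  interpret sorted_renaming \<Sigma> j ?N
    by unfold_locales (use sig N j in simp_all)
  let ?C = "transport \<Sigma> j ?N"
  have tuples_const: "map ?c as \<in> tuples ?N \<sigma>s \<and> map2 j \<sigma>s (map ?c as) = map Inl as"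
    if "as \<in> tuples A \<sigma>s" "set \<sigma>s \<subseteq> sorts \<Sigma>" for as \<sigma>s
    using that unfolding tuples_iff
  proof (induction rule: list_all2_induct)
    case (Cons a as \<sigma> \<sigma>s)
    then show ?case using cB[of \<sigma>] j[of \<sigma>] by auto
  qed simp
  have sub: "substructure \<Sigma> (copy Inl A) ?C"
    unfolding substructure_def
  proof (intro conjI ballI)
    show "is_structure \<Sigma> (copy Inl A)"
      by (rule is_structure_copy[OF _ A]) simp
    show "is_structure \<Sigma> ?C"
      by (rule is_structure_transport)
  next
    fix \<sigma> assume \<sigma>: "\<sigma> \<in> sorts \<Sigma>"
    then have "Inl ` carrier A \<sigma> = j \<sigma> ` ?c ` carrier A \<sigma>"
      using j[OF \<sigma>] by (simp add: image_image)
    then show "carrier (copy Inl A) \<sigma> \<subseteq> carrier ?C \<sigma>"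
      using cB[OF \<sigma>] by (auto simp: copy_def)
  next
    fix f and as :: "('a + 'k) list"
    assume f: "f \<in> funs \<Sigma>" and "as \<in> tuples (copy Inl A) (fst (fun_arity \<Sigma> f))"
    then obtain as' where as': "as = map Inl as'" "as' \<in> tuples A (fst (fun_arity \<Sigma> f))"
      by (auto simp: tuples_copy)
    have ar: "set (fst (fun_arity \<Sigma> f)) \<subseteq> sorts \<Sigma>" "snd (fun_arity \<Sigma> f) \<in> sorts \<Sigma>"
      using sig f by (auto simp: is_signature_def)
    note t = tuples_const[OF as'(2) ar(1)]
    have "fun_interp ?C f as = j (snd (fun_arity \<Sigma> f)) (fun_interp ?M f (map ?c as'))"
      using fun_interp_transport[OF f conjunct1[OF t]] unfolding conjunct2[OF t] upd as'(1) .
    also have "\<dots> = Inl (fun_interp A f as')"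
      unfolding fun_interp_ultrapower_const using j[OF ar(2)] by blast
    finally show "fun_interp (copy Inl A) f as = fun_interp ?C f as"
      by (simp add: copy_def as'(1) o_def)
  next
    fix p and as :: "('a + 'k) list"
    assume p: "p \<in> preds \<Sigma>" and "as \<in> tuples (copy Inl A) (pred_arity \<Sigma> p)"
    then obtain as' where as': "as = map Inl as'" "as' \<in> tuples A (pred_arity \<Sigma> p)"
      by (auto simp: tuples_copy)
    have ar: "set (pred_arity \<Sigma> p) \<subseteq> sorts \<Sigma>"
      using sig p by (auto simp: is_signature_def)
    note t = tuples_const[OF as'(2) ar]
    have "pred_interp ?C p as \<longleftrightarrow> pred_interp ?M p (map ?c as')"
      using pred_interp_transport[OF p conjunct1[OF t]] unfolding conjunct2[OF t] upd as'(1) .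
    then show "pred_interp (copy Inl A) p as \<longleftrightarrow> pred_interp ?C p as"
      unfolding pred_interp_ultrapower_const by (simp add: copy_def as'(1) o_def)
  qed
  have sat: "sat (copy Inl A) \<nu> \<phi> \<longleftrightarrow> sat ?C \<nu> \<phi>"
    if \<phi>: "is_formula \<Sigma> \<phi>" and \<nu>: "is_assignment \<Sigma> (copy Inl A) \<nu>" for \<phi> and \<nu> :: "'s var \<Rightarrow> 'a + 'k"
  proof -
    \<comment> \<open>At sorts outside the signature \<open>\<nu>\<close> may leave the range of
      \<open>Inl\<close>, where \<open>projl\<close> is unspecified; well-formed formulas contain no
      variables of such sorts.\<close>
    define \<mu> where "\<mu> = projl \<circ> \<nu>"
    have \<mu>: "\<nu> v = Inl (\<mu> v)" "\<mu> v \<in> carrier A (snd v)" if "snd v \<in> sorts \<Sigma>" for v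
    proof -
      have "\<nu> v \<in> Inl ` carrier A (snd v)"
        using \<nu> that by (cases v) (simp add: is_assignment_def copy_def)
      then show "\<nu> v = Inl (\<mu> v)" "\<mu> v \<in> carrier A (snd v)"
        by (auto simp: \<mu>_def)
    qed
    have "is_assignment \<Sigma> ?N (\<lambda>v. ?c (\<mu> v))"
      unfolding is_assignment_def upd using \<mu>(2) cB by fastforce
    then have N: "sat ?C (\<lambda>v. j (snd v) (?c (\<mu> v))) \<phi> \<longleftrightarrow> sat ?M (\<lambda>v. ?c (\<mu> v)) \<phi>"
      using sat_transport[OF \<phi>] elem \<phi> unfolding elementary_substructure_def by blast
    \<comment> \<open>The chain goes down to \<open>A\<close>, up to its ultrapower along constants,
      then through the cut-down structure and its renaming to \<open>?C\<close>.\<close>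
    have "sat (copy Inl A) \<nu> \<phi> \<longleftrightarrow> sat (copy (Inl :: 'a \<Rightarrow> 'a + 'k) A) (Inl \<circ> \<mu>) \<phi>"
      by (rule sat_cong) (use vars_sorts[OF sig \<phi>] \<mu>(1) in auto)
    also have "\<dots> \<longleftrightarrow> sat A \<mu> \<phi>"
      by (rule sat_copy) simp
    also have "\<dots> \<longleftrightarrow> sat ?C (\<lambda>v. j (snd v) (?c (\<mu> v))) \<phi>"
      unfolding N by (rule sat_ultrapower_const[symmetric])
    also have "\<dots> \<longleftrightarrow> sat ?C \<nu> \<phi>"
      by (rule sat_cong) (use vars_sorts[OF sig \<phi>] \<mu>(1) j in auto)
    finally show ?thesis .
  qed
  show ?thesis
  proof (intro exI[of _ ?C] conjI ballI)
    show "is_structure \<Sigma> ?C"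
      by (rule is_structure_transport)
    show "elementary_substructure \<Sigma> (copy Inl A) ?C"
      unfolding elementary_substructure_def using sub sat by blast
  next
    fix l \<sigma> assume l: "l \<in> \<Lambda>" "\<sigma> \<in> infinite_sorts \<Sigma> A \<inter> l"
    then have "inj_on (j \<sigma>) (B \<sigma>)" using j block_sorts by blast
    then have "|carrier ?C \<sigma>| =o |B \<sigma>|"
      unfolding carrier_transport upd
      by (rule ordIso_symmetric[OF card_of_ordIsoI[OF inj_on_imp_bij_betw]])
    then show "|carrier ?C \<sigma>| =o \<kappa> l"
      by (rule ordIso_transitive[OF _ B_infinite[OF l]])
  next
    fix \<sigma> assume "\<sigma> \<in> finite_sorts \<Sigma> A"
    then have \<sigma>: "\<sigma> \<in> sorts \<Sigma>" "\<sigma> \<notin> infinite_sorts \<Sigma> A"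
      by (auto simp: finite_sorts_def)
    show "carrier ?C \<sigma> = carrier (copy Inl A) \<sigma>"
      unfolding carrier_transport upd B_finite[OF \<sigma>] using j[OF \<sigma>(1)] by (simp add: copy_def image_image)
  qed
qed

end
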